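(* Let $p_0$ be a probability mass function (pmf) on $\mathbb{N}=\{0,1,2,\dots\}$ whose support is $\{0,\dots,S\}$ for some integer $S>0$, and assume that $p_0$ is convex on $\mathbb{N}$. Let $X_1,\dots,X_n$ be i.i.d. with pmf $p_0$, let $p_n$ be their empirical pmf, and let $\hat p_n$ be the least-squares projection of $p_n$ onto the set of convex pmfs on $\mathbb{N}$. Then, as $n\to\infty$, $$T_n^2 = n\,\|p_n-\hat p_n\|^2 \xrightarrow{d} \hat T_0:=\sum_{k=0}^{S+1}\big(\hat g_0(k)-g_0(k)\big)^2 ,$$ where $g_0$ and $\hat g_0$ are defined below.
   Context: The empirical pmf is $p_n(j)=n^{-1}\sum_{i=1}^n \mathbb{1}_{\{X_i=j\}}$, $j\in\mathbb{N}$. For a sequence $q=(q(j))_{j\in\mathbb{N}}$, $\|q\|^2=\sum_{j\in\mathbb{N}}q(j)^2$. For a sequence $p$ and $k\geq 1$, $\Delta p(k)=p(k+1)-2p(k)+p(k-1)$; $p$ is convex on $\mathbb{N}$ iff $\Delta p(k)\ge 0$ for all $k\ge 1$. An integer $k\geq1$ is a knot of $p$ if $\Delta p(k)>0$. $\hat p_n$ denotes the (unique) minimizer of $\|p_n-p\|^2$ over all convex pmfs $p$ on $\mathbb{N}$, and $T_n=\sqrt n\,\|p_n-\hat p_n\|$. $g_0=(g_0(0),\dots,g_0(S+1))$ is a centered Gaussian vector in $\mathbb{R}^{S+2}$ with $\mathrm{Cov}(g_0(i),g_0(j))=\mathbb{1}_{\{i=j\}}p_0(i)-p_0(i)p_0(j)$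 for $i,j=0,\dots,S+1$. $\mathcal K_0$ is the set of all $g=(g(0),\dots,g(S+1))\in\mathbb{R}^{S+2}$ such that $\Delta g(k)=g(k+1)-2g(k)+g(k-1)\geq 0$ for all $k\in\{1,\dots,S\}$, with possible exceptions at those $k$ that are knots of $p_0$. $\hat g_0$ is the (unique) minimizer of $\sum_{k=0}^{S+1}(g(k)-g_0(k))^2$ over $g\in\mathcal K_0$. *)

theory Defs
  imports "HOL-Probability.Probability"
begin

text \<open>Second difference of a sequence on the naturals (used for k \<ge> 1).\<close>
definition Delta2 :: "(nat \<Rightarrow> real) \<Rightarrow> nat \<Rightarrow> real" where
  "Delta2 p k = p (k + 1) - 2 * p k + p (k - 1)"

definition convex_seq :: "(nat \<Rightarrow> real) \<Rightarrow> bool" where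
  "convex_seq p \<longleftrightarrow> (\<forall>k\<ge>1. Delta2 p k \<ge> 0)"

definition is_pmf :: "(nat \<Rightarrow> real) \<Rightarrow> bool" where
  "is_pmf p \<longleftrightarrow> (\<forall>j. p j \<ge> 0) \<and> (p has_sum 1) UNIV"

definition convex_pmfs :: "(nat \<Rightarrow> real) set" where
  "convex_pmfs = {p. is_pmf p \<and> convex_seq p}"

definition sqnorm :: "(nat \<Rightarrow> real) \<Rightarrow> real" where
  "sqnorm q = (\<Sum>\<^sub>\<infinity>j. (q j)\<^sup>2)"

definition knot :: "(nat \<Rightarrow> real) \<Rightarrow> nat \<Rightarrow> bool" where
  "knot p k \<longleftrightarrow> k \<ge> 1 \<and> Delta2 p k > 0"

definition emp_pmf :: "(nat \<Rightarrow> 'a \<Rightarrow> nat) \<Rightarrow> nat \<Rightarrow> 'a \<Rightarrow> nat \<Rightarrow> real" where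
  "emp_pmf X n \<omega> j = real (card {i \<in> {1..n}. X i \<omega> = j}) / real n"

definition ls_proj :: "(nat \<Rightarrow> real) \<Rightarrow> (nat \<Rightarrow> real)" where
  "ls_proj q = (THE p. p \<in> convex_pmfs \<and>
      (\<forall>p'\<in>convex_pmfs. sqnorm (\<lambda>j. q j - p j) \<le> sqnorm (\<lambda>j. q j - p' j)))"

definition Tn_sq :: "(nat \<Rightarrow> 'a \<Rightarrow> nat) \<Rightarrow> nat \<Rightarrow> 'a \<Rightarrow> real" where
  "Tn_sq X n \<omega> = real n * sqnorm (\<lambda>j. emp_pmf X n \<omega> j - ls_proj (emp_pmf X n \<omega>) j)"

definition centered_gaussian_rv :: "'b measure \<Rightarrow> ('b \<Rightarrow> real) \<Rightarrow> real \<Rightarrow> bool" where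
  "centered_gaussian_rv N Y v \<longleftrightarrow>
     (v = 0 \<and> Y \<in> borel_measurable N \<and> (AE \<omega> in N. Y \<omega> = 0)) \<or>
     (v > 0 \<and> distributed N lborel Y (normal_density 0 (sqrt v)))"

definition centered_gaussian_vector ::
  "'b measure \<Rightarrow> nat set \<Rightarrow> ('b \<Rightarrow> nat \<Rightarrow> real) \<Rightarrow> (nat \<Rightarrow> nat \<Rightarrow> real) \<Rightarrow> bool" where
  "centered_gaussian_vector N I G C \<longleftrightarrow>
     (\<forall>c :: nat \<Rightarrow> real. centered_gaussian_rv N (\<lambda>\<omega>. \<Sum>k\<in>I. c k * G \<omega> k)
        (\<Sum>i\<in>I. \<Sum>j\<in>I. c i * c j * C i j))"

text \<open>The cone K_0 (vectors (g(0),...,g(S+1)) encoded as sequences vanishing beyond S+1).\<close>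
definition K0 :: "(nat \<Rightarrow> real) \<Rightarrow> nat \<Rightarrow> (nat \<Rightarrow> real) set" where
  "K0 p0 S = {g. (\<forall>k>S+1. g k = 0) \<and>
      (\<forall>k\<in>{1..S}. \<not> knot p0 k \<longrightarrow> Delta2 g k \<ge> 0)}"

definition proj_K0 :: "(nat \<Rightarrow> real) \<Rightarrow> nat \<Rightarrow> (nat \<Rightarrow> real) \<Rightarrow> (nat \<Rightarrow> real)" where
  "proj_K0 p0 S g0 = (THE g. g \<in> K0 p0 S \<and>
      (\<forall>g'\<in>K0 p0 S. (\<Sum>k=0..S+1. (g k - g0 k)\<^sup>2) \<le> (\<Sum>k=0..S+1. (g' k - g0 k)\<^sup>2)))"

definition T0_hat :: "(nat \<Rightarrow> real) \<Rightarrow> nat \<Rightarrow> (nat \<Rightarrow> real) \<Rightarrow> real" where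
  "T0_hat p0 S g0 = (\<Sum>k=0..S+1. (proj_K0 p0 S g0 k - g0 k)\<^sup>2)"

end

theory Submission
  imports Defs
begin

text \<open>
  Let \<open>x = p\<^sub>n - p\<^sub>0\<close> on \<open>{0..S+1}\<close> and let \<open>g\<close> be the projection of \<open>x\<close> onto the cone \<open>K\<^sub>0\<close>.
  If \<open>x\<close> is small, then \<open>p\<^sub>0 + g\<close> is itself a convex pmf: the cone contains the constants in both
  directions, so the total mass is preserved, and it contains the indicator of \<open>S + 1\<close>, so
  \<open>g (S + 1) \<ge> x (S + 1) = 0\<close>; all other constraints are strict at \<open>p\<^sub>0\<close> or part of \<open>K\<^sub>0\<close>. Conversely
  \<open>p - p\<^sub>0\<close> lies in \<open>K\<^sub>0\<close> for every convex pmf \<open>p\<close>. Hence the least-squares projection of \<open>p\<^sub>n\<close> is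
  exactly \<open>p\<^sub>0 + g\<close> with probability tending to one, and by homogeneity the statistic is then the squared
  distance of \<open>\<surd>n (p\<^sub>n - p\<^sub>0)\<close> to \<open>K\<^sub>0\<close>. The distance is continuous, so the multivariate central limit
  theorem, obtained from the one-dimensional one by the Cramer-Wold device, gives the limit. The device
  rests on uniform approximation by trigonometric polynomials, whose expectations depend on the laws of
  linear combinations of the coordinates only.
\<close>

section \<open>Functions of finitely many coordinates\<close>

definition depends_only_on :: "'i set \<Rightarrow> (('i \<Rightarrow> 'c) \<Rightarrow> 'd) \<Rightarrow> bool" where
  "depends_only_on I f \<longleftrightarrow> (\<forall>x y. (\<forall>k\<in>I. x k = y k) \<longrightarrow> f x = f y)"

lemma depends_only_onD: "depends_only_on I f \<Longrightarrow> (\<And>k. k \<in> I \<Longrightarrow> x k = y k) \<Longrightarrow> f x = f y"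
  unfolding depends_only_on_def by blast

lemma borel_measurable_continuous_coordinates:
  fixes f :: "('i::countable \<Rightarrow> real) \<Rightarrow> real"
  assumes cont: "continuous_on UNIV f" and dep: "depends_only_on I f"
    and V_measurable: "\<And>k. k \<in> I \<Longrightarrow> (\<lambda>\<omega>. V \<omega> k) \<in> borel_measurable M"
  shows "(\<lambda>\<omega>. f (V \<omega>)) \<in> borel_measurable M"
proof -
  define W where "W \<omega> k = (if k \<in> I then V \<omega> k else 0)" for \<omega> k
  have "(\<lambda>\<omega>. W \<omega> k) \<in> borel_measurable M" for k
    using V_measurable[of k] by (cases "k \<in> I") (auto simp: W_def)
  then have "W \<in> borel_measurable M"
    by (rule measurable_coordinatewise_then_product)
  then have "(\<lambda>\<omega>. f (W \<omega>)) \<in> borel_measurable M"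
    using borel_measurable_continuous_onI[OF cont] by measurable
  moreover have "f (W \<omega>) = f (V \<omega>)" for \<omega>
    by (rule depends_only_onD[OF dep]) (simp add: W_def)
  ultimately show ?thesis by simp
qed

lemma continuous_on_lipschitz_coordinates:
  fixes f :: "('i \<Rightarrow> real) \<Rightarrow> real"
  assumes lip: "\<And>x y. \<bar>f x - f y\<bar> \<le> C * (\<Sum>k\<in>I. \<bar>x k - y k\<bar>)"
  shows "continuous_on UNIV f"
  unfolding continuous_on_def
proof (intro ballI)
  fix a :: "'i \<Rightarrow> real"
  have coordinate_tendsto: "((\<lambda>x. x k) \<longlongrightarrow> a k) (at a)" for k
    using continuous_on_product_coordinates[of k] unfolding continuous_on_def by blast
  have "((\<lambda>x. C * (\<Sum>k\<in>I. \<bar>x k - a k\<bar>)) \<longlongrightarrow> C * (\<Sum>k\<in>I. \<bar>a k - a k\<bar>)) (at a)"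
    by (intro tendsto_intros coordinate_tendsto)
  then have "((\<lambda>x. C * (\<Sum>k\<in>I. \<bar>x k - a k\<bar>)) \<longlongrightarrow> 0) (at a)" by simp
  then have "((\<lambda>x. f x - f a) \<longlongrightarrow> 0) (at a)"
    by (rule Lim_null_comparison[rotated]) (simp add: lip)
  then show "(f \<longlongrightarrow> f a) (at a within UNIV)"
    by (simp add: Lim_null[symmetric])
qed

lemma compact_coordinatewise:
  fixes A :: "'i \<Rightarrow> real set"
  assumes "\<And>k. compact (A k)"
  shows "compact {x. \<forall>k. x k \<in> A k}"
proof -
  have "compactin (product_topology (\<lambda>_. euclidean) UNIV) (PiE UNIV A)"
    using assms by (simp add: compactin_PiE)
  then show ?thesis
    by (simp add: euclidean_product_topology PiE_UNIV_domain Pi_def)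
qed

section \<open>The Cramer-Wold device\<close>

inductive_set trig_poly :: "'i set \<Rightarrow> (('i \<Rightarrow> real) \<Rightarrow> real) set" for I where
  cos: "(\<lambda>x. a * cos ((\<Sum>k\<in>I. c k * x k) + b)) \<in> trig_poly I"
| add: "f \<in> trig_poly I \<Longrightarrow> g \<in> trig_poly I \<Longrightarrow> (\<lambda>x. f x + g x) \<in> trig_poly I"

lemma trig_poly_continuous: "f \<in> trig_poly I \<Longrightarrow> continuous_on UNIV f"
  for I :: "'i::countable set"
  by (induction rule: trig_poly.induct)
    (auto intro!: continuous_intros continuous_on_product_coordinates)

lemma trig_poly_depends_only_on: "f \<in> trig_poly I \<Longrightarrow> depends_only_on I f"
proof (induction rule: trig_poly.induct)
  case (cos a c b)
  then show ?case by (auto simp: depends_only_on_def cong: sum.cong)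
next
  case (add f g)
  then show ?case unfolding depends_only_on_def by metis
qed

lemma trig_poly_bounded: "f \<in> trig_poly I \<Longrightarrow> \<exists>C. \<forall>x. \<bar>f x\<bar> \<le> C"
proof (induction rule: trig_poly.induct)
  case (cos a c b)
  have "\<bar>a * cos ((\<Sum>k\<in>I. c k * x k) + b)\<bar> \<le> \<bar>a\<bar> * 1" for x
    unfolding abs_mult by (intro mult_left_mono) auto
  then show ?case by blast
next
  case (add f g)
  then obtain C D where "\<And>x. \<bar>f x\<bar> \<le> C" "\<And>x. \<bar>g x\<bar> \<le> D" by blast
  then have "\<bar>f x + g x\<bar> \<le> C + D" for x
    by (meson abs_triangle_ineq add_mono order_trans)
  then show ?case by blast
qed

lemma trig_poly_const: "(\<lambda>x. a) \<in> trig_poly I"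
  using trig_poly.cos[where a = a and c = "\<lambda>_. 0" and b = 0] by simp

lemma trig_poly_sin:
  assumes "finite I" "j \<in> I"
  shows "(\<lambda>x. sin (r * x j)) \<in> trig_poly I"
proof -
  have "(\<Sum>k\<in>I. (if k = j then r else 0) * x k) = r * x j" for x :: "'a \<Rightarrow> real"
    using assms by (simp add: if_distrib[of "\<lambda>t. t * _"] cong: if_cong)
  moreover have "cos (r * x j - pi / 2) = sin (r * x j)" for x :: "'a \<Rightarrow> real"
    by (simp add: cos_diff)
  ultimately show ?thesis
    using trig_poly.cos[where a = 1 and I = I and c = "\<lambda>k. if k = j then r else 0" and b = "- (pi / 2)"]
    by simp
qed

lemma trig_poly_cos_mult_cos:
  "(\<lambda>x. (a * cos ((\<Sum>k\<in>I. c k * x k) + b)) * (a' * cos ((\<Sum>k\<in>I. c' k * x k) + b'))) \<in> trig_poly I"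
proof -
  have "(a * cos ((\<Sum>k\<in>I. c k * x k) + b)) * (a' * cos ((\<Sum>k\<in>I. c' k * x k) + b')) =
      (a * a' / 2) * cos ((\<Sum>k\<in>I. (c k - c' k) * x k) + (b - b')) +
      (a * a' / 2) * cos ((\<Sum>k\<in>I. (c k + c' k) * x k) + (b + b'))" for x
  proof -
    define u v where "u = (\<Sum>k\<in>I. c k * x k) + b" and "v = (\<Sum>k\<in>I. c' k * x k) + b'"
    have "(\<Sum>k\<in>I. (c k - c' k) * x k) + (b - b') = u - v"
      by (simp add: u_def v_def algebra_simps sum_subtractf)
    moreover have "(\<Sum>k\<in>I. (c k + c' k) * x k) + (b + b') = u + v"
      by (simp add: u_def v_def algebra_simps sum.distrib)
    moreover have "a * cos u * (a' * cos v) = a * a' / 2 * cos (u - v) + a * a' / 2 * cos (u + v)"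
      by (simp add: cos_add cos_diff algebra_simps)
    ultimately show ?thesis
      by (simp only: u_def v_def)
  qed
  then show ?thesis
    by (simp only:) (intro trig_poly.intros)
qed

lemma trig_poly_mult:
  assumes "f \<in> trig_poly I" "g \<in> trig_poly I"
  shows "(\<lambda>x. f x * g x) \<in> trig_poly I"
  using assms(1)
proof induction
  case (cos a c b)
  show ?case
    using assms(2)
  proof induction
    case (cos a' c' b')
    show ?case by (rule trig_poly_cos_mult_cos)
  next
    case (add g h)
    then show ?case
      using trig_poly.add[OF add.IH] by (simp add: algebra_simps)
  qed
next
  case (add f h)
  then show ?case
    using trig_poly.add[OF add.IH] by (simp add: algebra_simps)
qed

definition unit_cube :: "'i set \<Rightarrow> ('i \<Rightarrow> real) set" where
  "unit_cube I = {y. \<forall>k. y k \<in> (if k \<in> I then {-1..1} else {0})}"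

definition coordinate_sines :: "'i set \<Rightarrow> real \<Rightarrow> ('i \<Rightarrow> real) \<Rightarrow> 'i \<Rightarrow> real" where
  "coordinate_sines I r x = (\<lambda>k. if k \<in> I then sin (r * x k) else 0)"

lemma coordinate_sines_in_unit_cube: "coordinate_sines I r x \<in> unit_cube I"
  by (auto simp: coordinate_sines_def unit_cube_def)

lemma unit_cube_bounds:
  assumes "y \<in> unit_cube I"
  shows "-1 \<le> y k" "y k \<le> 1"
  using assms unfolding unit_cube_def by (cases "k \<in> I"; auto dest: spec[of _ k])+

lemma trig_poly_approx_on_unit_cube:
  fixes f :: "('i::countable \<Rightarrow> real) \<Rightarrow> real"
  assumes "finite I" "continuous_on (unit_cube I) f" "e > 0"
  obtains P where "(\<lambda>x. P (coordinate_sines I r x)) \<in> trig_poly I"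
    "\<And>y. y \<in> unit_cube I \<Longrightarrow> \<bar>f y - P y\<bar> < e"
proof -
  define R where "R = {P. continuous_on (unit_cube I) P \<and> (\<lambda>x. P (coordinate_sines I r x)) \<in> trig_poly I}"
  interpret R: function_ring_on R "unit_cube I"
  proof
    show "compact (unit_cube I)"
      unfolding unit_cube_def by (intro compact_coordinatewise) auto
    fix x y assume cube: "x \<in> unit_cube I" "y \<in> unit_cube I" and "x \<noteq> y"
    then obtain k where "x k \<noteq> y k" by blast
    then have "k \<in> I"
      using cube unfolding unit_cube_def by (metis (mono_tags, lifting) mem_Collect_eq singletonD)
    then have "(\<lambda>x. coordinate_sines I r x k) \<in> trig_poly I"
      using trig_poly_sin[OF \<open>finite I\<close>, of k r] by (simp add: coordinate_sines_def)
    then have "(\<lambda>y. y k) \<in> R"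
      unfolding R_def
      by (intro CollectI conjI continuous_on_subset[OF continuous_on_product_coordinates]) auto
    with \<open>x k \<noteq> y k\<close> show "\<exists>f\<in>R. f x \<noteq> f y"
      by (intro bexI[of _ "\<lambda>y. y k"])
  next
    show "(\<lambda>x. f x + g x) \<in> R" "(\<lambda>x. f x * g x) \<in> R" if "f \<in> R" "g \<in> R" for f g
      using that unfolding R_def
      by (simp_all add: continuous_on_add continuous_on_mult trig_poly.add trig_poly_mult)
  qed (simp_all add: R_def trig_poly_const)
  obtain P where "P \<in> R" "\<forall>y\<in>unit_cube I. \<bar>f y - P y\<bar> < e"
    using R.Stone_Weierstrass_basic[OF assms(2,3)] by blast
  then show thesis by (intro that[of P]) (auto simp: R_def)
qed

text \<open>
  Composing \<open>f\<close> with \<open>L * arcsin\<close> turns an approximation on the cube \<open>\<bar>x k\<bar> \<le> L\<close> into a trigonometric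
  polynomial that remains bounded on the whole space.
\<close>

lemma trig_poly_approx_on_box:
  fixes f :: "('i::countable \<Rightarrow> real) \<Rightarrow> real"
  assumes "finite I" and cont: "continuous_on UNIV f" and dep: "depends_only_on I f"
    and bdd: "\<And>x. \<bar>f x\<bar> \<le> C" and "L > 0" "e > 0"
  obtains h where "h \<in> trig_poly I" "\<And>x. \<bar>h x\<bar> \<le> C + e"
    "\<And>x. (\<And>k. k \<in> I \<Longrightarrow> \<bar>x k\<bar> \<le> L) \<Longrightarrow> \<bar>f x - h x\<bar> \<le> e"
proof -
  let ?s = "coordinate_sines I (1 / L)"
  have "continuous_on (unit_cube I) (\<lambda>y. f (\<lambda>k. L * arcsin (y k)))"
  proof (rule continuous_on_compose2[OF cont])
    show "continuous_on (unit_cube I) (\<lambda>y k. L * arcsin (y k))"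
      by (intro continuous_on_coordinatewise_then_product continuous_on_mult continuous_on_const
          continuous_on_arcsin continuous_on_subset[OF continuous_on_product_coordinates])
        (use unit_cube_bounds in auto)
  qed simp
  from trig_poly_approx_on_unit_cube[OF \<open>finite I\<close> this \<open>e > 0\<close>, of "1 / L"]
  obtain P where trig: "(\<lambda>x. P (?s x)) \<in> trig_poly I"
    and approx: "\<And>y. y \<in> unit_cube I \<Longrightarrow> \<bar>f (\<lambda>k. L * arcsin (y k)) - P y\<bar> < e"
    by blast
  show thesis
  proof (rule that[OF trig])
    show "\<bar>P (?s x)\<bar> \<le> C + e" for x
      using approx[OF coordinate_sines_in_unit_cube, of "1 / L" x] bdd[of "\<lambda>k. L * arcsin (?s x k)"]
      by linarith
    fix x assume box: "\<And>k. k \<in> I \<Longrightarrow> \<bar>x k\<bar> \<le> L"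
    have "f (\<lambda>k. L * arcsin (?s x k)) = f x"
    proof (rule depends_only_onD[OF dep])
      fix k assume "k \<in> I"
      then have "\<bar>1 / L * x k\<bar> \<le> 1" using box \<open>L > 0\<close> by (simp add: abs_mult)
      then have "arcsin (sin (1 / L * x k)) = 1 / L * x k"
        using pi_gt3 by (intro arcsin_sin) linarith+
      then show "L * arcsin (?s x k) = x k"
        using \<open>k \<in> I\<close> \<open>L > 0\<close> by (simp add: coordinate_sines_def)
    qed
    then show "\<bar>f x - P (?s x)\<bar> \<le> e"
      using approx[OF coordinate_sines_in_unit_cube, of "1 / L" x] by simp
  qed
qed

lemma tendsto_if_approx_tendsto:
  fixes a :: "'c \<Rightarrow> real"
  assumes "\<And>e. e > 0 \<Longrightarrow> \<exists>b b'. (b \<longlongrightarrow> b') F \<and> (\<forall>\<^sub>F n in F. \<bar>a n - b n\<bar> \<le> e) \<and> \<bar>a' - b'\<bar> \<le> e"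
  shows "(a \<longlongrightarrow> a') F"
proof (rule tendstoI)
  fix e :: real assume "e > 0"
  then obtain b b' where b_tendsto: "(b \<longlongrightarrow> b') F"
    and approx: "\<forall>\<^sub>F n in F. \<bar>a n - b n\<bar> \<le> e / 4" "\<bar>a' - b'\<bar> \<le> e / 4"
    using assms[of "e / 4"] by auto
  have "\<forall>\<^sub>F n in F. dist (b n) b' < e / 4"
    using b_tendsto \<open>e > 0\<close> by (intro tendstoD) auto
  with approx(1) show "\<forall>\<^sub>F n in F. dist (a n) a' < e"
    by eventually_elim (use approx(2) \<open>e > 0\<close> in \<open>unfold dist_real_def, arith\<close>)
qed

lemma (in prob_space) abs_expectation_diff_le:
  fixes f g :: "'a \<Rightarrow> real"
  assumes "integrable M f" "integrable M g" "A \<in> events"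
    and "\<And>\<omega>. \<omega> \<in> space M \<Longrightarrow> \<bar>f \<omega> - g \<omega>\<bar> \<le> e + C * indicator A \<omega>"
  shows "\<bar>expectation f - expectation g\<bar> \<le> e + C * prob A"
proof -
  have "expectation f - expectation g = expectation (\<lambda>\<omega>. f \<omega> - g \<omega>)"
    using assms by simp
  also have "\<bar>\<dots>\<bar> \<le> expectation (\<lambda>\<omega>. \<bar>f \<omega> - g \<omega>\<bar>)"
    by (rule integral_abs_bound)
  also have "\<dots> \<le> expectation (\<lambda>\<omega>. e + C * indicator A \<omega>)"
    using assms by (intro integral_mono) (auto simp: integrable_indicator_iff less_top[symmetric])
  also have "\<dots> = e + C * prob A"
    using assms by (simp add: prob_space integrable_indicator_iff less_top[symmetric])
  finally show ?thesis .
qed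

lemma (in real_distribution) eventually_tail_less:
  assumes "e > 0"
  shows "\<forall>\<^sub>F R in at_top. measure M {x. R \<le> \<bar>x\<bar>} < e"
proof -
  have "(\<Inter>i. {x. real i \<le> \<bar>x\<bar>}) = {}"
    using reals_Archimedean2 by (auto simp flip: not_less)
  moreover have "(\<lambda>i. measure M {x. real i \<le> \<bar>x\<bar>}) \<longlonglongrightarrow> measure M (\<Inter>i. {x. real i \<le> \<bar>x\<bar>})"
    by (intro finite_Lim_measure_decseq) (auto simp: decseq_def)
  ultimately have "\<forall>\<^sub>F i in sequentially. measure M {x. real i \<le> \<bar>x\<bar>} < e"
    using assms by (intro order_tendstoD(2)[where y = "measure M {}"]) auto
  then obtain i :: nat where tail_i: "measure M {x. real i \<le> \<bar>x\<bar>} < e"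
    by (auto simp: eventually_sequentially)
  show ?thesis
    unfolding eventually_at_top_linorder
  proof (intro exI allI impI)
    fix R :: real assume "real i \<le> R"
    then have "measure M {x. R \<le> \<bar>x\<bar>} \<le> measure M {x. real i \<le> \<bar>x\<bar>}"
      by (intro finite_measure_mono) auto
    with tail_i show "measure M {x. R \<le> \<bar>x\<bar>} < e" by simp
  qed
qed

lemma weak_conv_m_imp_tight:
  assumes "\<And>n. real_distribution (\<mu> n)" "real_distribution \<nu>" "weak_conv_m \<mu> \<nu>" "e > 0"
  shows "\<forall>\<^sub>F R in at_top. \<forall>\<^sub>F n in sequentially. measure (\<mu> n) {x. R \<le> \<bar>x\<bar>} < e"
proof -
  interpret \<mu>: real_distribution "\<mu> n" for n by fact
  interpret \<nu>: real_distribution \<nu> by fact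
  obtain r where tail_r: "measure \<nu> {x. r \<le> \<bar>x\<bar>} < e"
    using eventually_happens[OF \<nu>.eventually_tail_less[OF \<open>e > 0\<close>]] by auto
  define \<phi> where "\<phi> x = max 0 (min 1 (\<bar>x\<bar> - r))" for x :: real
  have \<phi>_props: "isCont \<phi> x" "\<bar>\<phi> x\<bar> \<le> 1" "indicator {x. r + 1 \<le> \<bar>x\<bar>} x \<le> \<phi> x"
    "\<phi> x \<le> indicator {x. r \<le> \<bar>x\<bar>} x" for x
    unfolding \<phi>_def by (auto intro!: continuous_intros split: split_indicator)
  have [measurable]: "\<phi> \<in> borel_measurable borel"
    by (intro borel_measurable_continuous_onI continuous_at_imp_continuous_on ballI \<phi>_props(1))
  have "(\<integral>x. \<phi> x \<partial>\<nu>) \<le> (\<integral>x. indicator {x. r \<le> \<bar>x\<bar>} x \<partial>\<nu>)"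
    by (intro integral_mono \<phi>_props(4) \<nu>.integrable_const_bound[where B = 1]) (auto simp: \<phi>_props(2) split: split_indicator)
  with tail_r have "(\<integral>x. \<phi> x \<partial>\<nu>) < e" by simp
  moreover have "(\<lambda>n. \<integral>x. \<phi> x \<partial>\<mu> n) \<longlonglongrightarrow> (\<integral>x. \<phi> x \<partial>\<nu>)"
    using assms \<phi>_props by (intro weak_conv_imp_integral_bdd_continuous_conv[where B = 1]) auto
  ultimately have \<phi>_less: "\<forall>\<^sub>F n in sequentially. (\<integral>x. \<phi> x \<partial>\<mu> n) < e"
    by (intro order_tendstoD(2))
  have tail_le: "measure (\<mu> n) {x. R \<le> \<bar>x\<bar>} \<le> (\<integral>x. \<phi> x \<partial>\<mu> n)" if "r + 1 \<le> R" for n R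
  proof -
    have "measure (\<mu> n) {x. R \<le> \<bar>x\<bar>} \<le> measure (\<mu> n) {x. r + 1 \<le> \<bar>x\<bar>}"
      using that by (intro \<mu>.finite_measure_mono) auto
    also have "\<dots> = (\<integral>x. indicator {x. r + 1 \<le> \<bar>x\<bar>} x \<partial>\<mu> n)" by simp
    also have "\<dots> \<le> (\<integral>x. \<phi> x \<partial>\<mu> n)"
      by (intro integral_mono \<phi>_props(3) \<mu>.integrable_const_bound[where B = 1])
        (auto simp: \<phi>_props(2) split: split_indicator)
    finally show ?thesis .
  qed
  have "\<forall>\<^sub>F n in sequentially. measure (\<mu> n) {x. R \<le> \<bar>x\<bar>} < e" if "r + 1 \<le> R" for R
    using \<phi>_less by eventually_elim (use tail_le[OF that] in \<open>auto intro: le_less_trans\<close>)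
  then show ?thesis
    unfolding eventually_at_top_linorder[where 'a = real] by blast
qed

lemma (in prob_space) prob_Bex_le:
  assumes "finite I" "\<And>k. k \<in> I \<Longrightarrow> {\<omega> \<in> space M. P k \<omega>} \<in> events"
    and "\<And>k. k \<in> I \<Longrightarrow> prob {\<omega> \<in> space M. P k \<omega>} \<le> d"
  shows "prob {\<omega> \<in> space M. \<exists>k\<in>I. P k \<omega>} \<le> real (card I) * d"
proof -
  have "{\<omega> \<in> space M. \<exists>k\<in>I. P k \<omega>} = (\<Union>k\<in>I. {\<omega> \<in> space M. P k \<omega>})" by auto
  then have "prob {\<omega> \<in> space M. \<exists>k\<in>I. P k \<omega>} \<le> (\<Sum>k\<in>I. prob {\<omega> \<in> space M. P k \<omega>})"
    using assms by (simp add: finite_measure_subadditive_finite image_subset_iff)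
  also have "\<dots> \<le> (\<Sum>k\<in>I. d)"
    using assms by (intro sum_mono)
  finally show ?thesis by simp
qed

lemma (in prob_space) prob_Bex_abs_ge_le:
  fixes W :: "'a \<Rightarrow> 'i \<Rightarrow> real"
  assumes "finite I" "\<And>k. k \<in> I \<Longrightarrow> (\<lambda>\<omega>. W \<omega> k) \<in> borel_measurable M"
    and tail: "\<And>k. k \<in> I \<Longrightarrow> measure (distr M borel (\<lambda>\<omega>. W \<omega> k)) {x. R \<le> \<bar>x\<bar>} \<le> d"
  shows "prob {\<omega> \<in> space M. \<exists>k\<in>I. R \<le> \<bar>W \<omega> k\<bar>} \<le> real (card I) * d"
proof (rule prob_Bex_le)
  fix k assume "k \<in> I"
  note [measurable] = assms(2)[OF \<open>k \<in> I\<close>]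
  show "{\<omega> \<in> space M. R \<le> \<bar>W \<omega> k\<bar>} \<in> events" by measurable
  show "prob {\<omega> \<in> space M. R \<le> \<bar>W \<omega> k\<bar>} \<le> d"
    using tail[OF \<open>k \<in> I\<close>] by (simp add: measure_distr vimage_def Int_def conj_commute)
qed fact

lemma (in prob_space) abs_expectation_diff_le_if_close_on_box:
  fixes f h :: "('i \<Rightarrow> real) \<Rightarrow> real"
  assumes "finite I" and W_measurable: "\<And>k. k \<in> I \<Longrightarrow> (\<lambda>\<omega>. W \<omega> k) \<in> borel_measurable M"
    and "integrable M (\<lambda>\<omega>. f (W \<omega>))" "integrable M (\<lambda>\<omega>. h (W \<omega>))"
    and close_on_box: "\<And>x. (\<And>k. k \<in> I \<Longrightarrow> \<bar>x k\<bar> \<le> R) \<Longrightarrow> \<bar>f x - h x\<bar> \<le> e" and "0 \<le> e"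
    and bdd: "\<And>x. \<bar>f x - h x\<bar> \<le> C"
    and tail: "prob {\<omega> \<in> space M. \<exists>k\<in>I. R \<le> \<bar>W \<omega> k\<bar>} \<le> d"
  shows "\<bar>expectation (\<lambda>\<omega>. f (W \<omega>)) - expectation (\<lambda>\<omega>. h (W \<omega>))\<bar> \<le> e + C * d"
proof -
  note [measurable] = W_measurable
  let ?A = "{\<omega> \<in> space M. \<exists>k\<in>I. R \<le> \<bar>W \<omega> k\<bar>}"
  have "\<bar>expectation (\<lambda>\<omega>. f (W \<omega>)) - expectation (\<lambda>\<omega>. h (W \<omega>))\<bar> \<le> e + C * prob ?A"
  proof (rule abs_expectation_diff_le)
    show "?A \<in> events" using \<open>finite I\<close> by measurable
    fix \<omega> assume "\<omega> \<in> space M"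
    then show "\<bar>f (W \<omega>) - h (W \<omega>)\<bar> \<le> e + C * indicator ?A \<omega>"
      using close_on_box[of "W \<omega>"] bdd[of "W \<omega>"] \<open>0 \<le> e\<close> by (auto simp: indicator_def not_le less_imp_le)
  qed fact+
  also have "\<dots> \<le> e + C * d"
    using tail bdd[of undefined] by (intro add_left_mono mult_left_mono) auto
  finally show ?thesis .
qed

locale cramer_wold = M: prob_space M + N: prob_space N
  for M :: "'a measure" and N :: "'b measure" +
  fixes I :: "'i::countable set" and V :: "nat \<Rightarrow> 'a \<Rightarrow> 'i \<Rightarrow> real" and G :: "'b \<Rightarrow> 'i \<Rightarrow> real"
  assumes finite_index: "finite I"
    and V_measurable: "\<And>n k. k \<in> I \<Longrightarrow> (\<lambda>\<omega>. V n \<omega> k) \<in> borel_measurable M"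
    and G_measurable: "\<And>k. k \<in> I \<Longrightarrow> (\<lambda>\<omega>. G \<omega> k) \<in> borel_measurable N"
    and linear_weak_conv: "\<And>c. weak_conv_m (\<lambda>n. distr M borel (\<lambda>\<omega>. \<Sum>k\<in>I. c k * V n \<omega> k))
          (distr N borel (\<lambda>\<omega>. \<Sum>k\<in>I. c k * G \<omega> k))"
begin

lemma coordinate_weak_conv:
  assumes "k \<in> I"
  shows "weak_conv_m (\<lambda>n. distr M borel (\<lambda>\<omega>. V n \<omega> k)) (distr N borel (\<lambda>\<omega>. G \<omega> k))"
proof -
  have "(\<Sum>j\<in>I. of_bool (j = k) * x j) = x k" for x :: "'i \<Rightarrow> real"
    using assms finite_index by (simp add: of_bool_def if_distrib[of "\<lambda>t. t * _"] cong: if_cong)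
  then show ?thesis
    using linear_weak_conv[of "\<lambda>j. of_bool (j = k)"] by simp
qed

lemma coordinates_tight:
  assumes "e > 0"
  obtains R where "R > 0"
    "\<forall>\<^sub>F n in sequentially. M.prob {\<omega> \<in> space M. \<exists>k\<in>I. R \<le> \<bar>V n \<omega> k\<bar>} \<le> e"
    "N.prob {\<omega> \<in> space N. \<exists>k\<in>I. R \<le> \<bar>G \<omega> k\<bar>} \<le> e"
proof -
  define d where "d = e / (real (card I) + 1)"
  have "d > 0" "real (card I) * d \<le> e" using assms by (simp_all add: d_def field_simps)
  have "\<forall>\<^sub>F R in at_top. R > 0 \<and>
      (\<forall>k\<in>I. \<forall>\<^sub>F n in sequentially. measure (distr M borel (\<lambda>\<omega>. V n \<omega> k)) {x. R \<le> \<bar>x\<bar>} < d) \<and>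
      (\<forall>k\<in>I. measure (distr N borel (\<lambda>\<omega>. G \<omega> k)) {x. R \<le> \<bar>x\<bar>} < d)"
    by (intro eventually_conj eventually_gt_at_top eventually_ball_finite finite_index ballI
        weak_conv_m_imp_tight[OF _ _ coordinate_weak_conv] real_distribution.eventually_tail_less
        M.real_distribution_distr N.real_distribution_distr V_measurable G_measurable \<open>d > 0\<close>)
  then obtain R where "R > 0"
    and V_tail: "\<And>k. k \<in> I \<Longrightarrow> \<forall>\<^sub>F n in sequentially. measure (distr M borel (\<lambda>\<omega>. V n \<omega> k)) {x. R \<le> \<bar>x\<bar>} < d"
    and G_tail: "\<And>k. k \<in> I \<Longrightarrow> measure (distr N borel (\<lambda>\<omega>. G \<omega> k)) {x. R \<le> \<bar>x\<bar>} < d"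
    using eventually_happens[of _ "at_top :: real filter"] by force
  show thesis
  proof
    show "R > 0" by fact
    have "\<forall>\<^sub>F n in sequentially. \<forall>k\<in>I. measure (distr M borel (\<lambda>\<omega>. V n \<omega> k)) {x. R \<le> \<bar>x\<bar>} < d"
      using V_tail by (intro eventually_ball_finite finite_index) blast
    then show "\<forall>\<^sub>F n in sequentially. M.prob {\<omega> \<in> space M. \<exists>k\<in>I. R \<le> \<bar>V n \<omega> k\<bar>} \<le> e"
    proof eventually_elim
      case (elim n)
      then have "M.prob {\<omega> \<in> space M. \<exists>k\<in>I. R \<le> \<bar>V n \<omega> k\<bar>} \<le> real (card I) * d"
        by (intro M.prob_Bex_abs_ge_le finite_index V_measurable) (auto intro: less_imp_le)
      with \<open>real (card I) * d \<le> e\<close> show ?case by simp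
    qed
    have "N.prob {\<omega> \<in> space N. \<exists>k\<in>I. R \<le> \<bar>G \<omega> k\<bar>} \<le> real (card I) * d"
      by (intro N.prob_Bex_abs_ge_le finite_index G_measurable less_imp_le[OF G_tail])
    with \<open>real (card I) * d \<le> e\<close> show "N.prob {\<omega> \<in> space N. \<exists>k\<in>I. R \<le> \<bar>G \<omega> k\<bar>} \<le> e" by simp
  qed
qed

lemma trig_poly_integrable:
  assumes "h \<in> trig_poly I"
  shows "integrable M (\<lambda>\<omega>. h (V n \<omega>))" "integrable N (\<lambda>\<omega>. h (G \<omega>))"
proof -
  note h_measurable = borel_measurable_continuous_coordinates[OF trig_poly_continuous trig_poly_depends_only_on,
      OF assms assms]
  obtain C where "\<And>x. \<bar>h x\<bar> \<le> C" using trig_poly_bounded[OF assms] by blast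
  then show "integrable M (\<lambda>\<omega>. h (V n \<omega>))" "integrable N (\<lambda>\<omega>. h (G \<omega>))"
    using h_measurable[of "V n" M, OF V_measurable] h_measurable[of G N, OF G_measurable]
    by (auto intro!: M.integrable_const_bound[of _ C] N.integrable_const_bound[of _ C])
qed

lemma trig_poly_expectation_tendsto:
  assumes "h \<in> trig_poly I"
  shows "(\<lambda>n. \<integral>\<omega>. h (V n \<omega>) \<partial>M) \<longlonglongrightarrow> (\<integral>\<omega>. h (G \<omega>) \<partial>N)"
  using assms
proof induction
  case (cos a c b)
  note [measurable] = V_measurable G_measurable
  have "(\<lambda>n. \<integral>x. a * cos (x + b) \<partial>distr M borel (\<lambda>\<omega>. \<Sum>k\<in>I. c k * V n \<omega> k))
      \<longlonglongrightarrow> (\<integral>x. a * cos (x + b) \<partial>distr N borel (\<lambda>\<omega>. \<Sum>k\<in>I. c k * G \<omega> k))"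
  proof (rule weak_conv_imp_integral_bdd_continuous_conv[OF _ _ linear_weak_conv, where B = "\<bar>a\<bar>"])
    show "norm (a * cos (x + b)) \<le> \<bar>a\<bar>" for x
      using mult_left_mono[OF abs_cos_le_one[of "x + b"], of "\<bar>a\<bar>"] by (simp add: abs_mult)
  qed (auto intro!: M.real_distribution_distr N.real_distribution_distr continuous_intros)
  then show ?case
    by (subst (asm) (1 2) integral_distr) auto
next
  case (add g h)
  then show ?case
    using tendsto_add[OF add.IH] trig_poly_integrable by simp
qed

lemma expectation_approx_by_trig_poly:
  fixes f :: "('i \<Rightarrow> real) \<Rightarrow> real"
  assumes cont: "continuous_on UNIV f" and dep: "depends_only_on I f" and bdd: "\<And>x. \<bar>f x\<bar> \<le> C"
    and "e > 0"
  obtains h where "h \<in> trig_poly I"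
    "\<forall>\<^sub>F n in sequentially. \<bar>(\<integral>\<omega>. f (V n \<omega>) \<partial>M) - (\<integral>\<omega>. h (V n \<omega>) \<partial>M)\<bar> \<le> e"
    "\<bar>(\<integral>\<omega>. f (G \<omega>) \<partial>N) - (\<integral>\<omega>. h (G \<omega>) \<partial>N)\<bar> \<le> e"
proof -
  have "C \<ge> 0" using bdd[of undefined] by linarith
  define d where "d = e / 2 / (2 * C + e / 2)"
  have "d > 0" using \<open>C \<ge> 0\<close> \<open>e > 0\<close> by (simp add: d_def add_nonneg_pos)
  have total_error: "e / 2 + (2 * C + e / 2) * d = e"
    using \<open>C \<ge> 0\<close> \<open>e > 0\<close> by (simp add: d_def add_nonneg_eq_0_iff field_simps)
  obtain R where "R > 0"
    and V_tail: "\<forall>\<^sub>F n in sequentially. M.prob {\<omega> \<in> space M. \<exists>k\<in>I. R \<le> \<bar>V n \<omega> k\<bar>} \<le> d"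
    and G_tail: "N.prob {\<omega> \<in> space N. \<exists>k\<in>I. R \<le> \<bar>G \<omega> k\<bar>} \<le> d"
    using coordinates_tight[OF \<open>d > 0\<close>] .
  obtain h where trig: "h \<in> trig_poly I" and h_bdd: "\<And>x. \<bar>h x\<bar> \<le> C + e / 2"
    and close_on_box: "\<And>x. (\<And>k. k \<in> I \<Longrightarrow> \<bar>x k\<bar> \<le> R) \<Longrightarrow> \<bar>f x - h x\<bar> \<le> e / 2"
    using trig_poly_approx_on_box[OF finite_index cont dep bdd \<open>R > 0\<close>, of "e / 2"] \<open>e > 0\<close> by auto
  have diff_bdd: "\<bar>f x - h x\<bar> \<le> 2 * C + e / 2" for x
    using bdd[of x] h_bdd[of x] by linarith
  note f_measurable = borel_measurable_continuous_coordinates[OF cont dep]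
  show thesis
  proof (rule that[OF trig])
    show "\<forall>\<^sub>F n in sequentially. \<bar>(\<integral>\<omega>. f (V n \<omega>) \<partial>M) - (\<integral>\<omega>. h (V n \<omega>) \<partial>M)\<bar> \<le> e"
      using V_tail
    proof eventually_elim
      case (elim n)
      have "integrable M (\<lambda>\<omega>. f (V n \<omega>))"
        using bdd by (intro M.integrable_const_bound[of _ C] f_measurable V_measurable) auto
      from M.abs_expectation_diff_le_if_close_on_box[OF finite_index V_measurable this
          trig_poly_integrable(1)[OF trig] close_on_box _ diff_bdd elim]
      show ?case using total_error \<open>e > 0\<close> by simp
    qed
    have "integrable N (\<lambda>\<omega>. f (G \<omega>))"
      using bdd by (intro N.integrable_const_bound[of _ C] f_measurable G_measurable) auto
    from N.abs_expectation_diff_le_if_close_on_box[OF finite_index G_measurable this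
        trig_poly_integrable(2)[OF trig] close_on_box _ diff_bdd G_tail]
    show "\<bar>(\<integral>\<omega>. f (G \<omega>) \<partial>N) - (\<integral>\<omega>. h (G \<omega>) \<partial>N)\<bar> \<le> e" using total_error \<open>e > 0\<close> by simp
  qed
qed

theorem expectation_tendsto:
  fixes f :: "('i \<Rightarrow> real) \<Rightarrow> real"
  assumes "continuous_on UNIV f" "depends_only_on I f" "\<And>x. \<bar>f x\<bar> \<le> C"
  shows "(\<lambda>n. \<integral>\<omega>. f (V n \<omega>) \<partial>M) \<longlonglongrightarrow> (\<integral>\<omega>. f (G \<omega>) \<partial>N)"
proof (rule tendsto_if_approx_tendsto)
  fix e :: real assume "e > 0"
  then obtain h where "h \<in> trig_poly I"
    and "\<forall>\<^sub>F n in sequentially. \<bar>(\<integral>\<omega>. f (V n \<omega>) \<partial>M) - (\<integral>\<omega>. h (V n \<omega>) \<partial>M)\<bar> \<le> e"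
    and "\<bar>(\<integral>\<omega>. f (G \<omega>) \<partial>N) - (\<integral>\<omega>. h (G \<omega>) \<partial>N)\<bar> \<le> e"
    using expectation_approx_by_trig_poly[OF assms] by blast
  then show "\<exists>b b'. b \<longlonglongrightarrow> b' \<and>
      (\<forall>\<^sub>F n in sequentially. \<bar>(\<integral>\<omega>. f (V n \<omega>) \<partial>M) - b n\<bar> \<le> e) \<and> \<bar>(\<integral>\<omega>. f (G \<omega>) \<partial>N) - b'\<bar> \<le> e"
    using trig_poly_expectation_tendsto by blast
qed

corollary weak_conv_continuous_map:
  assumes cont: "continuous_on UNIV f" and dep: "depends_only_on I f"
  shows "weak_conv_m (\<lambda>n. distr M borel (\<lambda>\<omega>. f (V n \<omega>))) (distr N borel (\<lambda>\<omega>. f (G \<omega>)))"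
proof -
  note f_measurable = borel_measurable_continuous_coordinates[OF cont dep]
  have f_V: "(\<lambda>\<omega>. f (V n \<omega>)) \<in> borel_measurable M" for n
    by (intro f_measurable V_measurable)
  have f_G: "(\<lambda>\<omega>. f (G \<omega>)) \<in> borel_measurable N"
    by (intro f_measurable G_measurable)
  show ?thesis
  proof (rule integral_bdd_continuous_conv_imp_weak_conv)
    fix g :: "real \<Rightarrow> real" assume g_isCont: "\<And>x. isCont g x" and g_bdd: "\<And>x. \<bar>g x\<bar> \<le> 1"
    from g_isCont have g_cont: "continuous_on UNIV g" by (simp add: continuous_at_imp_continuous_on)
    from g_cont have g_meas: "g \<in> borel_measurable borel" by (rule borel_measurable_continuous_onI)
    have "(\<lambda>n. \<integral>\<omega>. g (f (V n \<omega>)) \<partial>M) \<longlonglongrightarrow> (\<integral>\<omega>. g (f (G \<omega>)) \<partial>N)"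
    proof (rule expectation_tendsto)
      show "continuous_on UNIV (\<lambda>x. g (f x))"
        by (rule continuous_on_compose2[OF g_cont cont]) simp
      show "depends_only_on I (\<lambda>x. g (f x))"
        using dep unfolding depends_only_on_def by metis
    qed (rule g_bdd)
    then show "(\<lambda>n. integral\<^sup>L (distr M borel (\<lambda>\<omega>. f (V n \<omega>))) g) \<longlonglongrightarrow> integral\<^sup>L (distr N borel (\<lambda>\<omega>. f (G \<omega>))) g"
      by (simp only: integral_distr[OF f_V g_meas] integral_distr[OF f_G g_meas])
  qed (intro M.real_distribution_distr N.real_distribution_distr f_V f_G)+
qed

end

section \<open>Weak convergence and the central limit theorem\<close>

lemma (in prob_space) weak_conv_m_if_eq_whp:
  assumes "real_distribution \<nu>"
    and [measurable]: "\<And>n. W n \<in> borel_measurable M" "\<And>n. Z n \<in> borel_measurable M"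
    and conv: "weak_conv_m (\<lambda>n. distr M borel (W n)) \<nu>"
    and whp: "(\<lambda>n. prob {\<omega> \<in> space M. Z n \<omega> \<noteq> W n \<omega>}) \<longlonglongrightarrow> 0"
  shows "weak_conv_m (\<lambda>n. distr M borel (Z n)) \<nu>"
proof (rule integral_bdd_continuous_conv_imp_weak_conv)
  fix f :: "real \<Rightarrow> real" assume f_isCont: "\<And>x. isCont f x" and f_bdd: "\<And>x. \<bar>f x\<bar> \<le> 1"
  from f_isCont have [measurable]: "f \<in> borel_measurable borel"
    by (intro borel_measurable_continuous_onI) (simp add: continuous_at_imp_continuous_on)
  have W_tendsto: "(\<lambda>n. expectation (\<lambda>\<omega>. f (W n \<omega>))) \<longlonglongrightarrow> integral\<^sup>L \<nu> f"
    using weak_conv_imp_integral_bdd_continuous_conv[OF _ assms(1) conv, of f 1] f_isCont f_bdd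
    by (simp add: real_distribution_distr integral_distr)
  have diff_le: "\<bar>expectation (\<lambda>\<omega>. f (Z n \<omega>)) - expectation (\<lambda>\<omega>. f (W n \<omega>))\<bar>
      \<le> 0 + 2 * prob {\<omega> \<in> space M. Z n \<omega> \<noteq> W n \<omega>}" for n
  proof (rule abs_expectation_diff_le)
    show "\<bar>f (Z n \<omega>) - f (W n \<omega>)\<bar> \<le> 0 + 2 * indicator {\<omega> \<in> space M. Z n \<omega> \<noteq> W n \<omega>} \<omega>"
      if "\<omega> \<in> space M" for \<omega>
      using f_bdd[of "Z n \<omega>"] f_bdd[of "W n \<omega>"] that by (auto simp: indicator_def)
  qed (auto intro: integrable_const_bound[where B = 1] simp: f_bdd)
  have "(\<lambda>n. expectation (\<lambda>\<omega>. f (Z n \<omega>)) - expectation (\<lambda>\<omega>. f (W n \<omega>))) \<longlonglongrightarrow> 0"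
  proof (rule Lim_null_comparison)
    show "(\<lambda>n. 2 * prob {\<omega> \<in> space M. Z n \<omega> \<noteq> W n \<omega>}) \<longlonglongrightarrow> 0"
      by (rule tendsto_mult_right_zero[OF whp])
  qed (use diff_le in simp)
  from tendsto_add[OF this W_tendsto] show "(\<lambda>n. integral\<^sup>L (distr M borel (Z n)) f) \<longlonglongrightarrow> integral\<^sup>L \<nu> f"
    by (simp add: integral_distr)
qed (use assms in \<open>auto intro: real_distribution_distr\<close>)

lemma (in prob_space) char_distr_eq_1:
  assumes [measurable]: "Y \<in> borel_measurable M" and "AE \<omega> in M. Y \<omega> = 0"
  shows "char (distr M borel Y) t = 1"
proof -
  have "char (distr M borel Y) t = expectation (\<lambda>\<omega>. iexp (t * Y \<omega>))"
    unfolding char_def by (rule integral_distr) auto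
  also have "\<dots> = expectation (\<lambda>\<omega>. 1)"
    using assms(2) by (intro integral_cong_AE) auto
  finally show ?thesis by (simp add: prob_space)
qed

lemma char_distr_divide:
  assumes [measurable]: "Y \<in> borel_measurable M" and "s \<noteq> 0"
  shows "char (distr M borel (\<lambda>\<omega>. Y \<omega> / s)) (t * s) = char (distr M borel Y) t"
proof -
  have "char (distr M borel (\<lambda>\<omega>. Y \<omega> / s)) (t * s) = (\<integral>\<omega>. iexp (t * s * (Y \<omega> / s)) \<partial>M)"
    unfolding char_def by (rule integral_distr) auto
  also have "\<dots> = (\<integral>\<omega>. iexp (t * Y \<omega>) \<partial>M)"
    using \<open>s \<noteq> 0\<close> by simp
  also have "\<dots> = char (distr M borel Y) t"
    unfolding char_def by (rule integral_distr[symmetric]) auto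
  finally show ?thesis .
qed

lemma centered_gaussian_rv_measurable:
  "centered_gaussian_rv M Y v \<Longrightarrow> Y \<in> borel_measurable M"
  unfolding centered_gaussian_rv_def using distributed_measurable by fastforce

lemma (in prob_space) char_centered_gaussian_rv:
  assumes "centered_gaussian_rv M Y v"
  shows "char (distr M borel Y) t = exp (- (t\<^sup>2 * v) / 2)"
proof -
  have Y_measurable [measurable]: "Y \<in> borel_measurable M"
    using assms by (rule centered_gaussian_rv_measurable)
  consider "v = 0" "AE \<omega> in M. Y \<omega> = 0" | "v > 0" "distributed M lborel Y (normal_density 0 (sqrt v))"
    using assms unfolding centered_gaussian_rv_def by auto
  then show ?thesis
  proof cases
    assume "v = 0" "AE \<omega> in M. Y \<omega> = 0"
    then show ?thesis using char_distr_eq_1[OF Y_measurable] by simp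
  next
    assume "v > 0" and density: "distributed M lborel Y (normal_density 0 (sqrt v))"
    have "distributed M lborel (\<lambda>\<omega>. Y \<omega> / sqrt v) std_normal_density"
      using \<open>v > 0\<close> density normal_standard_normal_convert[of "sqrt v" Y 0] by simp
    then have "distr M lborel (\<lambda>\<omega>. Y \<omega> / sqrt v) = std_normal_distribution"
      by (rule distributed_distr_eq_density)
    moreover have "distr M lborel (\<lambda>\<omega>. Y \<omega> / sqrt v) = distr M borel (\<lambda>\<omega>. Y \<omega> / sqrt v)"
      by (rule distr_cong) auto
    ultimately have "char (distr M borel (\<lambda>\<omega>. Y \<omega> / sqrt v)) (t * sqrt v) = exp (- (t\<^sup>2 * v) / 2)"
      using \<open>v > 0\<close> by (simp add: char_std_normal_distribution power_mult_distrib)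
    then show ?thesis
      using char_distr_divide[OF Y_measurable, of "sqrt v" t] \<open>v > 0\<close> by simp
  qed
qed

lemma (in prob_space) AE_eq_expectation_if_variance_eq_0:
  fixes Y :: "'a \<Rightarrow> real"
  assumes [measurable]: "Y \<in> borel_measurable M" and square_integrable: "integrable M (\<lambda>\<omega>. (Y \<omega>)\<^sup>2)"
    and "variance Y = 0"
  shows "AE \<omega> in M. Y \<omega> = expectation Y"
proof -
  have "integrable M Y"
    by (rule square_integrable_imp_integrable[OF _ square_integrable]) simp
  then have "integrable M (\<lambda>\<omega>. (Y \<omega> - expectation Y)\<^sup>2)"
    using square_integrable by (simp add: power2_diff)
  from integral_nonneg_eq_0_iff_AE[OF this] show ?thesis
    using assms(3) by simp
qed

lemma (in prob_space) char_normalized_iid_sum_tendsto: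
  fixes Y :: "nat \<Rightarrow> 'a \<Rightarrow> real"
  assumes indep: "indep_vars (\<lambda>_. borel) Y UNIV"
    and mean: "\<And>i. expectation (Y i) = m"
    and square_integrable: "\<And>i. integrable M (\<lambda>\<omega>. (Y i \<omega>)\<^sup>2)"
    and var: "\<And>i. variance (Y i) = v"
    and distr: "\<And>i. distr M borel (Y i) = \<mu>"
  shows "(\<lambda>n. char (distr M borel (\<lambda>\<omega>. (\<Sum>i<n. Y i \<omega> - m) / sqrt (real n))) t) \<longlonglongrightarrow> exp (- (t\<^sup>2 * v) / 2)"
proof -
  have [measurable]: "Y i \<in> borel_measurable M" for i
    using indep by (simp add: indep_vars_def2)
  have "v \<ge> 0" using var[of 0] by (metis variance_positive)
  show ?thesis
  proof (cases "v = 0")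
    case True
    have "AE \<omega> in M. Y i \<omega> = m" for i
      using AE_eq_expectation_if_variance_eq_0[OF _ square_integrable] var mean True by simp
    then have "AE \<omega> in M. \<forall>i. Y i \<omega> = m"
      by (simp add: AE_all_countable)
    then have "AE \<omega> in M. (\<Sum>i<n. Y i \<omega> - m) / sqrt (real n) = 0" for n
      by eventually_elim simp
    then show ?thesis
      using True by (simp add: char_distr_eq_1)
  next
    case False
    define \<sigma> where "\<sigma> = sqrt v"
    have \<sigma>_props: "\<sigma> > 0" "\<sigma>\<^sup>2 = v" using False \<open>v \<ge> 0\<close> by (auto simp: \<sigma>_def)
    let ?Z = "\<lambda>n \<omega>. (\<Sum>i<n. Y i \<omega> - m) / sqrt (real n)"
    have "weak_conv_m (\<lambda>n. distr M borel (\<lambda>\<omega>. (\<Sum>i<n. Y i \<omega> - m) / sqrt (real n * \<sigma>\<^sup>2))) std_normal_distribution"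
      by (rule central_limit_theorem[OF indep mean \<sigma>_props(1) square_integrable _ distr]) (simp add: var \<sigma>_props)
    then have "weak_conv_m (\<lambda>n. distr M borel (\<lambda>\<omega>. ?Z n \<omega> / \<sigma>)) std_normal_distribution"
      using \<sigma>_props(1) by (simp add: real_sqrt_mult)
    then have "(\<lambda>n. char (distr M borel (\<lambda>\<omega>. ?Z n \<omega> / \<sigma>)) (t * \<sigma>)) \<longlonglongrightarrow> char std_normal_distribution (t * \<sigma>)"
      by (intro levy_continuity1 real_distribution_distr real_dist_normal_dist) auto
    moreover have "char (distr M borel (\<lambda>\<omega>. ?Z n \<omega> / \<sigma>)) (t * \<sigma>) = char (distr M borel (?Z n)) t" for n
      using \<sigma>_props(1) by (intro char_distr_divide) auto
    ultimately show ?thesis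
      by (simp add: char_std_normal_distribution power_mult_distrib \<sigma>_props)
  qed
qed

corollary (in prob_space) central_limit_theorem_centered_gaussian_rv:
  fixes Y :: "nat \<Rightarrow> 'a \<Rightarrow> real"
  assumes "indep_vars (\<lambda>_. borel) Y UNIV" "\<And>i. expectation (Y i) = m"
    "\<And>i. integrable M (\<lambda>\<omega>. (Y i \<omega>)\<^sup>2)" "\<And>i. variance (Y i) = v" "\<And>i. distr M borel (Y i) = \<mu>"
    and "prob_space N" and gaussian: "centered_gaussian_rv N Z v"
  shows "weak_conv_m (\<lambda>n. distr M borel (\<lambda>\<omega>. (\<Sum>i<n. Y i \<omega> - m) / sqrt (real n))) (distr N borel Z)"
proof (rule levy_continuity)
  interpret N: prob_space N by fact
  have [measurable]: "Y i \<in> borel_measurable M" for i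
    using assms(1) by (simp add: indep_vars_def2)
  show "real_distribution (distr M borel (\<lambda>\<omega>. (\<Sum>i<n. Y i \<omega> - m) / sqrt (real n)))" for n
    by (intro real_distribution_distr) simp
  show "real_distribution (distr N borel Z)"
    by (intro N.real_distribution_distr centered_gaussian_rv_measurable[OF gaussian])
  show "(\<lambda>n. char (distr M borel (\<lambda>\<omega>. (\<Sum>i<n. Y i \<omega> - m) / sqrt (real n))) t) \<longlonglongrightarrow> char (distr N borel Z) t" for t
    unfolding N.char_centered_gaussian_rv[OF gaussian] using assms by (intro char_normalized_iid_sum_tendsto)
qed

lemma (in prob_space) indep_vars_reindex_inj:
  assumes indep: "indep_vars M' X (f ` I)" and inj: "inj_on f I"
  shows "indep_vars (\<lambda>i. M' (f i)) (\<lambda>i. X (f i)) I"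
  unfolding indep_vars_def2
proof (intro conjI ballI)
  show "random_variable (M' (f i)) (X (f i))" if "i \<in> I" for i
    using indep that by (auto simp: indep_vars_def2)
  have sets: "indep_sets (\<lambda>i. {X i -` A \<inter> space M |A. A \<in> sets (M' i)}) (f ` I)"
    using indep by (simp add: indep_vars_def2)
  show "indep_sets (\<lambda>i. {X (f i) -` A \<inter> space M |A. A \<in> sets (M' (f i))}) I"
  proof (rule indep_setsI)
    show "{X (f i) -` A \<inter> space M |A. A \<in> sets (M' (f i))} \<subseteq> events" if "i \<in> I" for i
      using sets that by (auto simp: indep_sets_def)
    fix A J assume J: "J \<noteq> {}" "J \<subseteq> I" "finite J"
      and A_preimage: "\<forall>j\<in>J. A j \<in> {X (f j) -` A \<inter> space M |A. A \<in> sets (M' (f j))}"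
    have inj_J: "inj_on f J" using inj J(2) by (rule inj_on_subset)
    define B where "B k = A (the_inv_into J f k)" for k
    have B_image: "B (f j) = A j" if "j \<in> J" for j
      using that inj_J by (simp add: B_def the_inv_into_f_f)
    have "prob (\<Inter>k\<in>f ` J. B k) = (\<Prod>k\<in>f ` J. prob (B k))"
      using J A_preimage B_image by (intro indep_setsD[OF sets]) auto
    then show "prob (\<Inter>j\<in>J. A j) = (\<Prod>j\<in>J. prob (A j))"
      using B_image by (simp add: prod.reindex[OF inj_J])
  qed
qed

section \<open>Projections onto closed convex sets of finitely supported vectors\<close>

definition nearest_in :: "'i set \<Rightarrow> ('i \<Rightarrow> real) set \<Rightarrow> ('i \<Rightarrow> real) \<Rightarrow> ('i \<Rightarrow> real) \<Rightarrow> bool" where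
  "nearest_in I K x g \<longleftrightarrow> g \<in> K \<and> (\<forall>h\<in>K. (\<Sum>k\<in>I. (g k - x k)\<^sup>2) \<le> (\<Sum>k\<in>I. (h k - x k)\<^sup>2))"

lemma nearest_in_scale:
  assumes K_scale: "\<And>h b. h \<in> K \<Longrightarrow> b > 0 \<Longrightarrow> (\<lambda>k. b * h k) \<in> K"
    and "a > 0" "nearest_in I K x g"
  shows "nearest_in I K (\<lambda>k. a * x k) (\<lambda>k. a * g k)"
  unfolding nearest_in_def
proof (intro conjI ballI)
  have "g \<in> K" and nearest: "\<And>h. h \<in> K \<Longrightarrow> (\<Sum>k\<in>I. (g k - x k)\<^sup>2) \<le> (\<Sum>k\<in>I. (h k - x k)\<^sup>2)"
    using assms(3) by (auto simp: nearest_in_def)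
  show "(\<lambda>k. a * g k) \<in> K" using K_scale \<open>g \<in> K\<close> \<open>a > 0\<close> by blast
  fix h assume "h \<in> K"
  have "(\<Sum>k\<in>I. (a * g k - a * x k)\<^sup>2) = a\<^sup>2 * (\<Sum>k\<in>I. (g k - x k)\<^sup>2)"
    by (simp only: sum_distrib_left power_mult_distrib right_diff_distrib[symmetric])
  also have "\<dots> \<le> a\<^sup>2 * (\<Sum>k\<in>I. (1 / a * h k - x k)\<^sup>2)"
    using K_scale[OF \<open>h \<in> K\<close>, of "1 / a"] nearest \<open>a > 0\<close> by (intro mult_left_mono) auto
  also have "\<dots> = (\<Sum>k\<in>I. (a * (1 / a * h k - x k))\<^sup>2)"
    by (simp only: sum_distrib_left power_mult_distrib)
  also have "\<dots> = (\<Sum>k\<in>I. (h k - a * x k)\<^sup>2)"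
    using \<open>a > 0\<close> by (simp add: right_diff_distrib)
  finally show "(\<Sum>k\<in>I. (a * g k - a * x k)\<^sup>2) \<le> (\<Sum>k\<in>I. (h k - a * x k)\<^sup>2)" .
qed

lemma nearest_in_L2_set_le:
  assumes "nearest_in I K x g" "h \<in> K"
  shows "L2_set (\<lambda>k. g k - x k) I \<le> L2_set (\<lambda>k. h k - y k) I + (\<Sum>k\<in>I. \<bar>x k - y k\<bar>)"
proof -
  have "L2_set (\<lambda>k. g k - x k) I \<le> L2_set (\<lambda>k. (h k - y k) + (y k - x k)) I"
    using assms by (simp add: nearest_in_def L2_set_def)
  also have "\<dots> \<le> L2_set (\<lambda>k. h k - y k) I + L2_set (\<lambda>k. y k - x k) I"
    by (rule L2_set_triangle_ineq)
  also have "\<dots> \<le> L2_set (\<lambda>k. h k - y k) I + (\<Sum>k\<in>I. \<bar>y k - x k\<bar>)"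
    by (intro add_left_mono L2_set_le_sum_abs)
  finally show ?thesis by (simp only: abs_minus_commute)
qed

lemma linear_coeff_nonneg_if_quadratic_nonneg:
  fixes a b :: real
  assumes "\<And>t. 0 < t \<Longrightarrow> t \<le> 1 \<Longrightarrow> 0 \<le> t * a + t\<^sup>2 * b"
  shows "a \<ge> 0"
proof (rule tendsto_lowerbound)
  show "((\<lambda>t. a + t * b) \<longlongrightarrow> a) (at_right 0)"
    by (auto intro!: tendsto_eq_intros)
  have "0 \<le> a + t * b" if "0 < t" "t < 1" for t
  proof -
    have "0 \<le> t * (a + t * b)"
      using assms[of t] that by (simp add: power2_eq_square algebra_simps)
    with \<open>0 < t\<close> show ?thesis by (simp add: zero_le_mult_iff)
  qed
  then show "\<forall>\<^sub>F t in at_right 0. 0 \<le> a + t * b"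
    unfolding eventually_at_right_field by (intro exI[of _ 1]) auto
qed simp

locale closed_convex_on =
  fixes I :: "'i::countable set" and K :: "('i \<Rightarrow> real) set"
  assumes finite_index: "finite I"
    and vanishes_off: "\<And>g k. g \<in> K \<Longrightarrow> k \<notin> I \<Longrightarrow> g k = 0"
    and closed: "closed K"
    and nonempty: "K \<noteq> {}"
    and convex_comb: "\<And>g h t. g \<in> K \<Longrightarrow> h \<in> K \<Longrightarrow> 0 \<le> t \<Longrightarrow> t \<le> 1 \<Longrightarrow> (\<lambda>k. (1 - t) * g k + t * h k) \<in> K"
begin

lemma nearest_in_exists: "\<exists>g. nearest_in I K x g"
proof -
  obtain g0 where "g0 \<in> K" using nonempty by blast
  define F where "F g = (\<Sum>k\<in>I. (g k - x k)\<^sup>2)" for g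
  define Q where "Q = {g. \<forall>k. g k \<in> (if k \<in> I then {x k - sqrt (F g0)..x k + sqrt (F g0)} else {0})}"
  have sublevel: "h \<in> Q" if "h \<in> K" "F h \<le> F g0" for h
  proof -
    have "\<bar>h k - x k\<bar> \<le> sqrt (F g0)" if "k \<in> I" for k
    proof -
      have "(h k - x k)\<^sup>2 \<le> F h"
        unfolding F_def using \<open>k \<in> I\<close> finite_index by (intro member_le_sum) auto
      with \<open>F h \<le> F g0\<close> show ?thesis
        using real_sqrt_le_mono[of "(h k - x k)\<^sup>2" "F g0"] by simp
    qed
    then show ?thesis
      using vanishes_off[OF \<open>h \<in> K\<close>] by (force simp: Q_def abs_le_iff)
  qed
  have "compact (Q \<inter> K)"
    unfolding Q_def by (intro compact_Int_closed compact_coordinatewise closed) auto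
  moreover have "continuous_on (Q \<inter> K) F"
    unfolding F_def
    by (intro continuous_intros continuous_on_subset[OF continuous_on_product_coordinates]) auto
  ultimately obtain g where "g \<in> Q \<inter> K" and minimal: "\<And>h. h \<in> Q \<inter> K \<Longrightarrow> F g \<le> F h"
    using continuous_attains_inf[of "Q \<inter> K" F] sublevel[OF \<open>g0 \<in> K\<close>] \<open>g0 \<in> K\<close> by blast
  have "F g \<le> F h" if "h \<in> K" for h
    using minimal sublevel \<open>g0 \<in> K\<close> that by (metis IntI linear order_trans)
  then show ?thesis using \<open>g \<in> Q \<inter> K\<close> unfolding nearest_in_def F_def by blast
qed

lemma nearest_in_obtuse_angle:
  assumes nearest_g: "nearest_in I K x g" and "h \<in> K"
  shows "0 \<le> (\<Sum>k\<in>I. (g k - x k) * (h k - g k))"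
proof -
  have "0 \<le> t * (2 * (\<Sum>k\<in>I. (g k - x k) * (h k - g k))) + t\<^sup>2 * (\<Sum>k\<in>I. (h k - g k)\<^sup>2)"
    if "0 < t" "t \<le> 1" for t
  proof -
    have "(\<Sum>k\<in>I. (g k - x k)\<^sup>2) \<le> (\<Sum>k\<in>I. ((1 - t) * g k + t * h k - x k)\<^sup>2)"
      using convex_comb[of g h t] nearest_g \<open>h \<in> K\<close> that by (auto simp: nearest_in_def)
    also have "\<dots> = (\<Sum>k\<in>I. (g k - x k)\<^sup>2 + t * (2 * ((g k - x k) * (h k - g k))) + t\<^sup>2 * (h k - g k)\<^sup>2)"
      by (intro sum.cong refl) (simp add: power2_eq_square algebra_simps)
    also have "\<dots> = (\<Sum>k\<in>I. (g k - x k)\<^sup>2) +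
        (t * (2 * (\<Sum>k\<in>I. (g k - x k) * (h k - g k))) + t\<^sup>2 * (\<Sum>k\<in>I. (h k - g k)\<^sup>2))"
      by (simp only: sum.distrib sum_distrib_left add.assoc)
    finally show ?thesis by simp
  qed
  from linear_coeff_nonneg_if_quadratic_nonneg[OF this] show ?thesis by simp
qed

lemma nearest_in_pythagoras:
  assumes "nearest_in I K x g" "h \<in> K"
  shows "(\<Sum>k\<in>I. (g k - x k)\<^sup>2) + (\<Sum>k\<in>I. (h k - g k)\<^sup>2) \<le> (\<Sum>k\<in>I. (h k - x k)\<^sup>2)"
proof -
  have "(\<Sum>k\<in>I. (h k - x k)\<^sup>2) =
      (\<Sum>k\<in>I. (g k - x k)\<^sup>2 + (h k - g k)\<^sup>2 + 2 * ((g k - x k) * (h k - g k)))"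
    by (intro sum.cong refl) (simp add: power2_eq_square algebra_simps)
  also have "\<dots> = (\<Sum>k\<in>I. (g k - x k)\<^sup>2) + (\<Sum>k\<in>I. (h k - g k)\<^sup>2)
      + 2 * (\<Sum>k\<in>I. (g k - x k) * (h k - g k))"
    by (simp only: sum.distrib sum_distrib_left)
  finally show ?thesis
    using nearest_in_obtuse_angle[OF assms] by simp
qed

lemma nearest_in_unique:
  assumes nearest_g: "nearest_in I K x g" and nearest_h: "nearest_in I K x h"
  shows "g = h"
proof
  fix k
  have "h \<in> K" "g \<in> K" using nearest_g nearest_h by (auto simp: nearest_in_def)
  then have "(\<Sum>k\<in>I. (h k - g k)\<^sup>2) \<le> 0"
    using nearest_in_pythagoras[OF nearest_g \<open>h \<in> K\<close>] nearest_h by (force simp: nearest_in_def)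
  then have "(\<Sum>k\<in>I. (h k - g k)\<^sup>2) = 0"
    by (intro antisym sum_nonneg) auto
  then have "k \<in> I \<Longrightarrow> g k = h k"
    using finite_index by (simp add: sum_nonneg_eq_0_iff)
  then show "g k = h k"
    using vanishes_off[OF \<open>h \<in> K\<close>] vanishes_off[OF \<open>g \<in> K\<close>] by (cases "k \<in> I") auto
qed

lemma nearest_in_The: "nearest_in I K x (THE g. nearest_in I K x g)"
  using nearest_in_exists nearest_in_unique by (metis theI)

lemma nearest_in_abs_le:
  assumes nearest_g: "nearest_in I K x g" and zero: "(\<lambda>_. 0) \<in> K"
  shows "\<bar>g k\<bar> \<le> (\<Sum>k\<in>I. \<bar>x k\<bar>)"
proof (cases "k \<in> I")
  case True
  have "(\<Sum>k\<in>I. (g k)\<^sup>2) \<le> (\<Sum>k\<in>I. (x k)\<^sup>2)"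
    using nearest_in_pythagoras[OF nearest_g zero] sum_nonneg[of I "\<lambda>k. (g k - x k)\<^sup>2"] by simp
  moreover have "\<bar>g k\<bar> \<le> L2_set (\<lambda>k. \<bar>g k\<bar>) I"
    using True finite_index by (rule member_le_L2_set[rotated])
  ultimately have "\<bar>g k\<bar> \<le> L2_set x I"
    unfolding L2_set_def by (auto intro: order_trans)
  also have "\<dots> \<le> (\<Sum>k\<in>I. \<bar>x k\<bar>)"
    by (rule L2_set_le_sum_abs)
  finally show ?thesis .
next
  case False
  then have "g k = 0"
    using nearest_g vanishes_off by (simp add: nearest_in_def)
  then show ?thesis by (simp add: sum_nonneg)
qed

end

section \<open>The cone of directions\<close>

lemma K0_add: "g \<in> K0 p0 S \<Longrightarrow> h \<in> K0 p0 S \<Longrightarrow> (\<lambda>k. g k + h k) \<in> K0 p0 S"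
  by (force simp: K0_def Delta2_def)

lemma K0_scale:
  assumes "g \<in> K0 p0 S" "a \<ge> 0"
  shows "(\<lambda>k. a * g k) \<in> K0 p0 S"
proof -
  have "Delta2 (\<lambda>k. a * g k) k = a * Delta2 g k" for k
    by (simp add: Delta2_def algebra_simps)
  with assms show ?thesis by (auto simp: K0_def)
qed

lemma K0_zero: "(\<lambda>_. 0) \<in> K0 p0 S"
  by (simp add: K0_def Delta2_def)

lemma K0_const: "(\<lambda>k. if k \<le> S + 1 then t else 0) \<in> K0 p0 S"
  by (auto simp: K0_def Delta2_def)

lemma K0_indicator_last: "(\<lambda>k. if k = S + 1 then 1 else 0) \<in> K0 p0 S"
  by (auto simp: K0_def Delta2_def)

lemma closed_K0: "closed (K0 p0 S)"
proof -
  have "K0 p0 S = (\<Inter>k\<in>{S+1<..}. {g. g k = 0}) \<inter>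
      (\<Inter>k\<in>{k\<in>{1..S}. \<not> knot p0 k}. {g. 0 \<le> g (k + 1) - 2 * g k + g (k - 1)})"
    by (auto simp: K0_def Delta2_def)
  then show ?thesis
    by (simp only:) (intro closed_Int closed_INT ballI closed_Collect_eq closed_Collect_le
        continuous_intros continuous_on_product_coordinates)
qed

interpretation K0: closed_convex_on "{0..S+1}" "K0 p0 S" for p0 S
proof
  show "(\<lambda>k. (1 - t) * g k + t * h k) \<in> K0 p0 S"
    if "g \<in> K0 p0 S" "h \<in> K0 p0 S" "0 \<le> t" "t \<le> 1" for g h t
    using that by (intro K0_add K0_scale) auto
  show "K0 p0 S \<noteq> {}" using K0_zero by blast
qed (auto simp: closed_K0, simp add: K0_def)

lemma nearest_in_proj_K0: "nearest_in {0..S+1} (K0 p0 S) x (proj_K0 p0 S x)"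
proof -
  have "proj_K0 p0 S x = (THE g. nearest_in {0..S+1} (K0 p0 S) x g)"
    by (simp only: proj_K0_def nearest_in_def)
  then show ?thesis by (simp only: K0.nearest_in_The)
qed

lemma proj_K0_in: "proj_K0 p0 S x \<in> K0 p0 S"
  using nearest_in_proj_K0 by (simp add: nearest_in_def)

lemma T0_hat_scale:
  assumes "a > 0"
  shows "T0_hat p0 S (\<lambda>k. a * x k) = a\<^sup>2 * T0_hat p0 S x"
proof -
  have "nearest_in {0..S+1} (K0 p0 S) (\<lambda>k. a * x k) (\<lambda>k. a * proj_K0 p0 S x k)"
    by (rule nearest_in_scale[OF _ assms nearest_in_proj_K0]) (auto intro: K0_scale)
  then have "proj_K0 p0 S (\<lambda>k. a * x k) = (\<lambda>k. a * proj_K0 p0 S x k)"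
    by (rule K0.nearest_in_unique[OF nearest_in_proj_K0])
  then show ?thesis
    by (simp only: T0_hat_def sum_distrib_left power_mult_distrib right_diff_distrib[symmetric])
qed

lemma sqrt_T0_hat_lipschitz:
  "\<bar>sqrt (T0_hat p0 S x) - sqrt (T0_hat p0 S y)\<bar> \<le> (\<Sum>k\<in>{0..S+1}. \<bar>x k - y k\<bar>)"
proof -
  have "sqrt (T0_hat p0 S u) \<le> sqrt (T0_hat p0 S v) + (\<Sum>k\<in>{0..S+1}. \<bar>u k - v k\<bar>)" for u v
    using nearest_in_L2_set_le[OF nearest_in_proj_K0 proj_K0_in]
    by (simp add: L2_set_def T0_hat_def)
  from this[of x y] this[of y x] show ?thesis
    by (simp only: abs_le_iff abs_minus_commute[of "y _"]) linarith
qed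

lemma continuous_on_T0_hat: "continuous_on UNIV (T0_hat p0 S)"
proof -
  have "continuous_on UNIV (\<lambda>x. sqrt (T0_hat p0 S x))"
    by (rule continuous_on_lipschitz_coordinates[where C = 1 and I = "{0..S+1}"])
      (use sqrt_T0_hat_lipschitz in simp)
  then have "continuous_on UNIV (\<lambda>x. (sqrt (T0_hat p0 S x))\<^sup>2)"
    by (intro continuous_on_power)
  then show ?thesis
    by (simp add: T0_hat_def sum_nonneg)
qed

lemma depends_only_on_T0_hat: "depends_only_on {0..S+1} (T0_hat p0 S)"
  unfolding depends_only_on_def
proof (intro allI impI)
  fix x y :: "nat \<Rightarrow> real" assume "\<forall>k\<in>{0..S+1}. x k = y k"
  then show "T0_hat p0 S x = T0_hat p0 S y"
    using sqrt_T0_hat_lipschitz[of p0 S x y] by simp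
qed

lemma T0_hat_measurable:
  assumes "\<And>k. k \<in> {0..S+1} \<Longrightarrow> (\<lambda>\<omega>. V \<omega> k) \<in> borel_measurable M"
  shows "(\<lambda>\<omega>. T0_hat p0 S (V \<omega>)) \<in> borel_measurable M"
  using borel_measurable_continuous_coordinates[OF continuous_on_T0_hat depends_only_on_T0_hat assms] .

lemma proj_K0_variational:
  assumes "h \<in> K0 p0 S"
  shows "0 \<le> (\<Sum>k=0..S+1. (proj_K0 p0 S x k - x k) * h k)"
  using K0.nearest_in_obtuse_angle[OF nearest_in_proj_K0 K0_add[OF proj_K0_in[of p0 S x] assms], of x]
  by (simp only: add_diff_cancel_left')

lemma sum_proj_K0: "(\<Sum>k=0..S+1. proj_K0 p0 S x k) = (\<Sum>k=0..S+1. x k)"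
proof -
  have "0 \<le> t * (\<Sum>k=0..S+1. proj_K0 p0 S x k - x k)" for t
    using proj_K0_variational[OF K0_const[of S t p0], of x]
    by (simp add: sum_distrib_left mult.commute del: sum.cl_ivl_Suc)
  from this[of 1] this[of "-1"] show ?thesis
    by (simp add: sum_subtractf del: sum.cl_ivl_Suc)
qed

lemma proj_K0_last_ge: "x (S + 1) \<le> proj_K0 p0 S x (S + 1)"
  using proj_K0_variational[OF K0_indicator_last[of S p0], of x] by simp

lemma abs_proj_K0_le: "\<bar>proj_K0 p0 S x k\<bar> \<le> (\<Sum>k=0..S+1. \<bar>x k\<bar>)"
  by (rule K0.nearest_in_abs_le[OF nearest_in_proj_K0 K0_zero])

section \<open>The least-squares projection near a convex pmf\<close>

lemma is_pmf_finite_support: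
  assumes "finite A" "\<And>j. j \<notin> A \<Longrightarrow> p j = 0"
  shows "is_pmf p \<longleftrightarrow> (\<forall>j. p j \<ge> 0) \<and> (\<Sum>j\<in>A. p j) = 1"
proof -
  have "(p has_sum (\<Sum>j\<in>A. p j)) UNIV"
    by (rule has_sum_finite_neutralI[of A]) (use assms in auto)
  then show ?thesis
    unfolding is_pmf_def by (metis has_sum_unique)
qed

lemma is_pmf_le_1:
  assumes "is_pmf p"
  shows "p j \<le> 1"
proof -
  have "(p has_sum p j) {j}" using has_sum_finite[of "{j}" p] by simp
  moreover have "(p has_sum 1) UNIV" "\<And>j. p j \<ge> 0" using assms by (auto simp: is_pmf_def)
  ultimately show ?thesis using has_sum_mono_neutral[of p "{j}" "p j" p UNIV 1] by simp
qed

lemma is_pmf_square_summable: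
  assumes "is_pmf p"
  shows "(\<lambda>j. (p j)\<^sup>2) summable_on UNIV"
proof (rule summable_on_comparison_test)
  show "p summable_on UNIV"
    using assms by (auto simp: is_pmf_def summable_on_def)
  show "(p j)\<^sup>2 \<le> p j" for j
    using assms is_pmf_le_1[OF assms, of j] by (auto simp: is_pmf_def power2_eq_square intro: mult_left_le)
qed simp

lemma is_pmf_diff_square_summable:
  assumes "is_pmf p" "is_pmf q"
  shows "(\<lambda>j. (p j - q j)\<^sup>2) summable_on UNIV"
proof (rule summable_on_comparison_test)
  show "(\<lambda>j. (p j)\<^sup>2 + (q j)\<^sup>2) summable_on UNIV"
    using assms by (intro summable_on_add is_pmf_square_summable)
  show "(p j - q j)\<^sup>2 \<le> (p j)\<^sup>2 + (q j)\<^sup>2" for j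
    using assms by (simp add: is_pmf_def power2_diff)
qed simp

lemma sqnorm_nonneg: "sqnorm q \<ge> 0"
  unfolding sqnorm_def by (intro infsum_nonneg) simp

lemma ls_proj_eqI:
  assumes p_in: "p \<in> convex_pmfs"
    and pythagoras: "\<And>p'. p' \<in> convex_pmfs \<Longrightarrow>
      sqnorm (\<lambda>j. q j - p j) + sqnorm (\<lambda>j. p j - p' j) \<le> sqnorm (\<lambda>j. q j - p' j)"
  shows "ls_proj q = p"
  unfolding ls_proj_def
proof (rule the_equality)
  have minimal: "sqnorm (\<lambda>j. q j - p j) \<le> sqnorm (\<lambda>j. q j - p' j)" if "p' \<in> convex_pmfs" for p'
    using pythagoras[OF that] sqnorm_nonneg[of "\<lambda>j. p j - p' j"] by linarith
  with p_in show "p \<in> convex_pmfs \<and> (\<forall>p'\<in>convex_pmfs. sqnorm (\<lambda>j. q j - p j) \<le> sqnorm (\<lambda>j. q j - p' j))"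
    by blast
  fix p' assume "p' \<in> convex_pmfs \<and> (\<forall>r\<in>convex_pmfs. sqnorm (\<lambda>j. q j - p' j) \<le> sqnorm (\<lambda>j. q j - r j))"
  then have p'_in: "p' \<in> convex_pmfs" and "sqnorm (\<lambda>j. q j - p' j) \<le> sqnorm (\<lambda>j. q j - p j)"
    using p_in by blast+
  then have "sqnorm (\<lambda>j. p j - p' j) \<le> 0"
    using pythagoras[OF p'_in] by simp
  moreover have "(\<lambda>j. (p j - p' j)\<^sup>2) summable_on UNIV"
    using p_in p'_in by (intro is_pmf_diff_square_summable) (auto simp: convex_pmfs_def)
  ultimately have "(p j - p' j)\<^sup>2 = 0" for j
    unfolding sqnorm_def by (intro nonneg_infsum_le_0D[where A = UNIV]) auto
  then show "p' = p" by (intro ext) simp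
qed

lemma sqnorm_diff_split:
  assumes q_zero: "\<And>j. j > m \<Longrightarrow> q j = 0" and pmf: "is_pmf p"
  shows "sqnorm (\<lambda>j. q j - p j) = (\<Sum>j=0..m. (q j - p j)\<^sup>2) + (\<Sum>\<^sub>\<infinity>j\<in>{m<..}. (p j)\<^sup>2)"
proof -
  have tail: "(\<lambda>j. (p j)\<^sup>2) summable_on {m<..}"
    using is_pmf_square_summable[OF pmf] by (rule summable_on_subset_banach) auto
  have "sqnorm (\<lambda>j. q j - p j) = (\<Sum>\<^sub>\<infinity>j\<in>{0..m} \<union> {m<..}. (q j - p j)\<^sup>2)"
    unfolding sqnorm_def by (intro infsum_cong_neutral) auto
  also have "\<dots> = (\<Sum>\<^sub>\<infinity>j\<in>{0..m}. (q j - p j)\<^sup>2) + (\<Sum>\<^sub>\<infinity>j\<in>{m<..}. (q j - p j)\<^sup>2)"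
  proof (rule infsum_Un_disjoint)
    show "(\<lambda>j. (q j - p j)\<^sup>2) summable_on {m<..}"
      using tail by (rule summable_on_cong[THEN iffD1, rotated]) (use q_zero in auto)
  qed auto
  also have "(\<Sum>\<^sub>\<infinity>j\<in>{m<..}. (q j - p j)\<^sup>2) = (\<Sum>\<^sub>\<infinity>j\<in>{m<..}. (p j)\<^sup>2)"
    by (intro infsum_cong) (use q_zero in auto)
  finally show ?thesis by simp
qed

locale supported_convex_pmf =
  fixes p0 :: "nat \<Rightarrow> real" and S :: nat
  assumes pmf: "is_pmf p0"
    and support: "p0 j > 0 \<longleftrightarrow> j \<le> S"
    and convex: "convex_seq p0"
begin

lemma zero_beyond_support: "j > S \<Longrightarrow> p0 j = 0"
  using pmf support[of j] by (auto simp: is_pmf_def not_le less_le)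

lemma sum_p0: "(\<Sum>j=0..S+1. p0 j) = 1"
  using pmf is_pmf_finite_support[of "{0..S+1}" p0] zero_beyond_support by auto

lemma knot_last: "knot p0 (S + 1)"
  using zero_beyond_support support[of S] by (simp add: knot_def Delta2_def)

lemma knot_le:
  assumes "knot p0 k"
  shows "k \<le> S + 1"
proof (rule ccontr)
  assume "\<not> k \<le> S + 1"
  then have "Delta2 p0 k = 0" using zero_beyond_support by (simp add: Delta2_def)
  with assms show False by (simp add: knot_def)
qed

lemma margin_exists:
  obtains m where "m > 0" "\<And>j. j \<le> S \<Longrightarrow> m \<le> p0 j" "\<And>k. knot p0 k \<Longrightarrow> m \<le> Delta2 p0 k"
proof -
  define A where "A = p0 ` {..S} \<union> Delta2 p0 ` {k. knot p0 k}"
  have "{k. knot p0 k} \<subseteq> {..S+1}" using knot_le by blast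
  then have "finite {k. knot p0 k}" by (rule finite_subset) simp
  then have "finite A" "A \<noteq> {}" by (auto simp: A_def)
  show thesis
  proof (rule that)
    show "Min A > 0"
      using \<open>finite A\<close> \<open>A \<noteq> {}\<close> support by (auto simp: A_def knot_def)
    show "Min A \<le> p0 j" if "j \<le> S" for j
      using that \<open>finite A\<close> by (intro Min_le) (auto simp: A_def)
    show "Min A \<le> Delta2 p0 k" if "knot p0 k" for k
      using that \<open>finite A\<close> by (intro Min_le) (auto simp: A_def)
  qed
qed

lemma convex_seq_perturbation:
  assumes g_in: "g \<in> K0 p0 S" and nonneg: "\<And>j. p0 j + g j \<ge> 0"
    and small: "\<And>j. \<bar>g j\<bar> \<le> m / 4" and margin: "\<And>k. knot p0 k \<Longrightarrow> m \<le> Delta2 p0 k"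
  shows "convex_seq (\<lambda>j. p0 j + g j)"
  unfolding convex_seq_def
proof (intro allI impI)
  fix k :: nat assume "k \<ge> 1"
  have Delta2_sum: "Delta2 (\<lambda>j. p0 j + g j) k = Delta2 p0 k + Delta2 g k"
    by (simp add: Delta2_def)
  consider "knot p0 k" | "k \<le> S" "\<not> knot p0 k" | "k > S + 1"
    using knot_last by (metis Suc_eq_plus1 le_Suc_eq not_le)
  then show "Delta2 (\<lambda>j. p0 j + g j) k \<ge> 0"
  proof cases
    assume "knot p0 k"
    moreover have "Delta2 g k \<ge> - m"
      using small[of k] small[of "k + 1"] small[of "k - 1"] unfolding Delta2_def by linarith
    ultimately show ?thesis using margin[of k] by (simp add: Delta2_sum)
  next
    assume "k \<le> S" "\<not> knot p0 k"
    with g_in \<open>k \<ge> 1\<close> have "Delta2 g k \<ge> 0" by (simp add: K0_def)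
    moreover have "Delta2 p0 k \<ge> 0" using convex \<open>k \<ge> 1\<close> by (simp add: convex_seq_def)
    ultimately show ?thesis by (simp add: Delta2_sum)
  next
    assume "k > S + 1"
    then have "p0 j + g j = 0" if "j \<in> {k, k + 1}" for j
      using that g_in zero_beyond_support by (auto simp: K0_def)
    then show ?thesis using nonneg[of "k - 1"] by (simp add: Delta2_def)
  qed
qed

lemma convex_pmf_perturbation:
  assumes g_in: "g \<in> K0 p0 S" and last: "g (S + 1) \<ge> 0" and mass: "(\<Sum>k=0..S+1. g k) = 0"
    and small: "\<And>j. \<bar>g j\<bar> \<le> m / 4"
    and margin: "\<And>j. j \<le> S \<Longrightarrow> m \<le> p0 j" "\<And>k. knot p0 k \<Longrightarrow> m \<le> Delta2 p0 k"
  shows "(\<lambda>j. p0 j + g j) \<in> convex_pmfs"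
proof -
  have vanishes: "p0 j + g j = 0" if "j > S + 1" for j
    using that g_in zero_beyond_support[of j] by (simp add: K0_def)
  have nonneg: "p0 j + g j \<ge> 0" for j
  proof -
    consider "j \<le> S" | "j = S + 1" | "j > S + 1" by linarith
    then show ?thesis
    proof cases
      assume "j \<le> S"
      with margin(1)[of j] small[of j] show ?thesis by linarith
    next
      assume "j = S + 1"
      with last zero_beyond_support[of j] show ?thesis by simp
    qed (simp add: vanishes)
  qed
  have "(\<Sum>j=0..S+1. p0 j + g j) = 1"
    by (simp only: sum.distrib mass sum_p0)
  then have "is_pmf (\<lambda>j. p0 j + g j)"
    using nonneg vanishes is_pmf_finite_support[of "{0..S+1}" "\<lambda>j. p0 j + g j"] by auto
  moreover have "convex_seq (\<lambda>j. p0 j + g j)"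
    using convex_seq_perturbation[OF g_in nonneg small margin(2)] .
  ultimately show ?thesis by (simp add: convex_pmfs_def)
qed

definition direction :: "(nat \<Rightarrow> real) \<Rightarrow> nat \<Rightarrow> real" where
  "direction p k = (if k \<le> S + 1 then p k - p0 k else 0)"

lemma direction_in_K0:
  assumes "p \<in> convex_pmfs"
  shows "direction p \<in> K0 p0 S"
proof -
  have "Delta2 (direction p) k \<ge> 0" if "k \<in> {1..S}" "\<not> knot p0 k" for k
  proof -
    have "Delta2 p0 k \<le> 0" using that by (auto simp: knot_def)
    moreover have "Delta2 p k \<ge> 0" using assms that by (simp add: convex_pmfs_def convex_seq_def)
    moreover have "Delta2 (direction p) k = Delta2 p k - Delta2 p0 k"
      using that by (auto simp: Delta2_def direction_def)
    ultimately show ?thesis by simp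
  qed
  then show ?thesis by (auto simp: K0_def direction_def)
qed

lemma sqnorm_diff_eq_direction:
  assumes "\<And>j. j > S + 1 \<Longrightarrow> q j = 0" and "is_pmf p"
  shows "sqnorm (\<lambda>j. q j - p j) =
    (\<Sum>j=0..S+1. (direction p j - (q j - p0 j))\<^sup>2) + (\<Sum>\<^sub>\<infinity>j\<in>{S+1<..}. (p j)\<^sup>2)"
proof -
  have "(\<Sum>j=0..S+1. (q j - p j)\<^sup>2) = (\<Sum>j=0..S+1. (direction p j - (q j - p0 j))\<^sup>2)"
    by (intro sum.cong) (auto simp: direction_def power2_commute)
  then show ?thesis
    using sqnorm_diff_split[OF assms] by simp
qed

lemma
  assumes q_zero: "\<And>j. j > S + 1 \<Longrightarrow> q j = 0"
  defines "x \<equiv> \<lambda>j. q j - p0 j"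
  defines "p \<equiv> \<lambda>j. p0 j + proj_K0 p0 S x j"
  assumes p_in: "p \<in> convex_pmfs"
  shows ls_proj_eq_perturbation: "ls_proj q = p"
    and sqnorm_diff_perturbation: "sqnorm (\<lambda>j. q j - p j) = T0_hat p0 S x"
proof -
  have "is_pmf p" using p_in by (simp add: convex_pmfs_def)
  have vanishes: "p j = 0" if "j > S + 1" for j
    using that proj_K0_in[of p0 S x] zero_beyond_support[of j] by (simp add: p_def K0_def)
  then have "(\<Sum>\<^sub>\<infinity>j\<in>{S+1<..}. (p j)\<^sup>2) = 0" by (intro infsum_0) auto
  moreover have "(\<Sum>j=0..S+1. (direction p j - x j)\<^sup>2) = T0_hat p0 S x"
    unfolding T0_hat_def by (intro sum.cong) (auto simp: direction_def p_def)
  ultimately show sqnorm_p: "sqnorm (\<lambda>j. q j - p j) = T0_hat p0 S x"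
    using sqnorm_diff_eq_direction[OF q_zero \<open>is_pmf p\<close>] by (simp add: x_def)
  show "ls_proj q = p"
  proof (rule ls_proj_eqI[OF p_in])
    fix p' assume p'_in: "p' \<in> convex_pmfs"
    then have "is_pmf p'" by (simp add: convex_pmfs_def)
    have "T0_hat p0 S x + (\<Sum>j=0..S+1. (direction p' j - proj_K0 p0 S x j)\<^sup>2)
        \<le> (\<Sum>j=0..S+1. (direction p' j - x j)\<^sup>2)"
      unfolding T0_hat_def by (rule K0.nearest_in_pythagoras[OF nearest_in_proj_K0 direction_in_K0[OF p'_in]])
    moreover have "p j - p0 j = proj_K0 p0 S x j" for j by (simp add: p_def)
    ultimately show "sqnorm (\<lambda>j. q j - p j) + sqnorm (\<lambda>j. p j - p' j) \<le> sqnorm (\<lambda>j. q j - p' j)"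
      using sqnorm_diff_eq_direction[OF q_zero \<open>is_pmf p'\<close>] sqnorm_diff_eq_direction[OF vanishes \<open>is_pmf p'\<close>]
      by (simp only: sqnorm_p x_def)
  qed
qed

lemma sqnorm_ls_proj_near:
  obtains \<delta> where "\<delta> > 0"
    "\<And>q. (\<And>j. j \<in> {0..S+1} \<Longrightarrow> \<bar>q j - p0 j\<bar> < \<delta>) \<Longrightarrow> (\<And>j. j > S \<Longrightarrow> q j = 0) \<Longrightarrow>
      (\<Sum>j=0..S+1. q j) = 1 \<Longrightarrow> sqnorm (\<lambda>j. q j - ls_proj q j) = T0_hat p0 S (\<lambda>j. q j - p0 j)"
proof -
  obtain m where "m > 0" and margin: "\<And>j. j \<le> S \<Longrightarrow> m \<le> p0 j" "\<And>k. knot p0 k \<Longrightarrow> m \<le> Delta2 p0 k"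
    using margin_exists by blast
  define \<delta> where "\<delta> = m / (4 * (real S + 2))"
  show thesis
  proof (rule that)
    show "\<delta> > 0" using \<open>m > 0\<close> by (simp add: \<delta>_def)
    fix q assume near: "\<And>j. j \<in> {0..S+1} \<Longrightarrow> \<bar>q j - p0 j\<bar> < \<delta>" and q_zero: "\<And>j. j > S \<Longrightarrow> q j = 0"
      and q_sum: "(\<Sum>j=0..S+1. q j) = 1"
    define g where "g = proj_K0 p0 S (\<lambda>j. q j - p0 j)"
    have "(\<Sum>k=0..S+1. \<bar>q k - p0 k\<bar>) \<le> (\<Sum>k=0..S+1. \<delta>)"
      using near by (intro sum_mono) (auto intro: less_imp_le)
    also have "\<dots> = m / 4"
      by (simp add: \<delta>_def field_simps del: sum.cl_ivl_Suc)
    finally have small: "\<bar>g j\<bar> \<le> m / 4" for j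
      unfolding g_def by (rule order_trans[OF abs_proj_K0_le])
    have last: "0 \<le> g (S + 1)"
      using proj_K0_last_ge[of "\<lambda>j. q j - p0 j" S p0] q_zero zero_beyond_support by (simp add: g_def)
    have mass: "(\<Sum>k=0..S+1. g k) = 0"
      by (simp only: g_def sum_proj_K0 sum_subtractf q_sum sum_p0 diff_self)
    have "(\<lambda>j. p0 j + g j) \<in> convex_pmfs"
      using convex_pmf_perturbation[OF _ last mass small margin] by (simp add: g_def proj_K0_in)
    then show "sqnorm (\<lambda>j. q j - ls_proj q j) = T0_hat p0 S (\<lambda>j. q j - p0 j)"
      using ls_proj_eq_perturbation[of q] sqnorm_diff_perturbation[of q] q_zero by (simp add: g_def)
  qed
qed

end

section \<open>Samples from a pmf\<close>

lemma pmf_with_finite_support_exists: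
  assumes "is_pmf p" "finite A" "\<And>j. j \<notin> A \<Longrightarrow> p j = 0"
  obtains P where "pmf P = p"
proof
  have nonneg: "\<And>j. p j \<ge> 0" and "(\<Sum>j\<in>A. p j) = 1"
    using assms is_pmf_finite_support[OF assms(2,3)] by auto
  then have "(\<integral>\<^sup>+j. ennreal (p j) \<partial>count_space UNIV) = 1"
    using assms by (subst nn_integral_count_space'[of A]) (auto simp: sum_ennreal)
  with nonneg show "pmf (embed_pmf p) = p"
    by (intro ext pmf_embed_pmf)
qed

lemma integrable_measure_pmf_finite_support:
  fixes f :: "'c \<Rightarrow> real"
  assumes "finite I" "\<And>j. j \<notin> I \<Longrightarrow> f j = 0"
  shows "integrable (measure_pmf P) f"
proof (rule measure_pmf.integrable_const_bound)
  have "\<bar>f j\<bar> \<le> (\<Sum>j\<in>I. \<bar>f j\<bar>)" for j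
    using assms by (cases "j \<in> I") (auto intro: member_le_sum sum_nonneg)
  then show "AE j in measure_pmf P. norm (f j) \<le> (\<Sum>j\<in>I. \<bar>f j\<bar>)" by simp
qed simp

definition multinomial_cov :: "('c \<Rightarrow> real) \<Rightarrow> 'c \<Rightarrow> 'c \<Rightarrow> real" where
  "multinomial_cov p i j = (if i = j then p i else 0) - p i * p j"

lemma variance_measure_pmf_finite_support:
  fixes f :: "'c \<Rightarrow> real"
  assumes "finite I" "\<And>j. j \<notin> I \<Longrightarrow> f j = 0"
  shows "measure_pmf.variance P f =
    (\<Sum>i\<in>I. \<Sum>j\<in>I. f i * f j * multinomial_cov (pmf P) i j)"
proof -
  have expectation_eq_sum: "measure_pmf.expectation P g = (\<Sum>j\<in>I. g j * pmf P j)"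
    if "\<And>j. j \<notin> I \<Longrightarrow> g j = 0" for g
    using assms(1) that by (intro integral_measure_pmf_real) auto
  have "measure_pmf.variance P f = measure_pmf.expectation P (\<lambda>x. (f x)\<^sup>2) - (measure_pmf.expectation P f)\<^sup>2"
    using assms by (intro measure_pmf.variance_eq integrable_measure_pmf_finite_support[of I]) auto
  also have "\<dots> = (\<Sum>j\<in>I. (f j)\<^sup>2 * pmf P j) - (\<Sum>i\<in>I. \<Sum>j\<in>I. f i * f j * (pmf P i * pmf P j))"
    using assms(2) by (simp add: expectation_eq_sum power2_eq_square sum_product algebra_simps)
  also have "(\<Sum>j\<in>I. (f j)\<^sup>2 * pmf P j) = (\<Sum>i\<in>I. \<Sum>j\<in>I. f i * f j * (if i = j then pmf P i else 0))"
    using assms(1) by (simp add: if_distrib[of "\<lambda>x. _ * x"] power2_eq_square cong: if_cong)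
  finally show ?thesis
    by (simp only: multinomial_cov_def right_diff_distrib sum_subtractf)
qed

lemma (in prob_space) distr_eq_measure_pmf:
  fixes X :: "'a \<Rightarrow> 'c::countable"
  assumes X_measurable: "X \<in> measurable M (count_space UNIV)"
    and "\<And>j. prob {\<omega> \<in> space M. X \<omega> = j} = pmf P j"
  shows "distr M (count_space UNIV) X = measure_pmf P"
proof (rule measure_eqI_countable[where A = UNIV])
  fix j
  have "emeasure (distr M (count_space UNIV) X) {j} = emeasure M {\<omega> \<in> space M. X \<omega> = j}"
    using X_measurable by (subst emeasure_distr) (auto intro!: arg_cong[where f = "emeasure M"])
  then show "emeasure (distr M (count_space UNIV) X) {j} = emeasure (measure_pmf P) {j}"
    using assms(2) by (simp add: emeasure_eq_measure emeasure_pmf_single)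
qed auto

locale iid_sample = prob_space M for M :: "'a measure" +
  fixes X :: "nat \<Rightarrow> 'a \<Rightarrow> 'c" and P :: "'c pmf"
  assumes indep: "indep_vars (\<lambda>_. count_space UNIV) X {1..}"
    and law: "\<And>i. i \<ge> 1 \<Longrightarrow> distr M (count_space UNIV) (X i) = measure_pmf P"
begin

lemma X_measurable: "i \<ge> 1 \<Longrightarrow> X i \<in> measurable M (count_space UNIV)"
  using indep by (simp add: indep_vars_def2)

lemma distr_compose_X:
  assumes "i \<ge> 1"
  shows "distr M borel (\<lambda>\<omega>. f (X i \<omega>)) = distr (measure_pmf P) borel f"
proof -
  have "distr (distr M (count_space UNIV) (X i)) borel f = distr M borel (f \<circ> X i)"
    by (rule distr_distr) (auto simp: X_measurable[OF assms])
  then show ?thesis by (simp add: law[OF assms] o_def)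
qed

lemma expectation_X:
  fixes f :: "'c \<Rightarrow> real"
  assumes "i \<ge> 1"
  shows "expectation (\<lambda>\<omega>. f (X i \<omega>)) = measure_pmf.expectation P f"
  using integral_distr[OF X_measurable[OF assms], of f] by (simp add: law[OF assms])

lemma integrable_X_iff:
  fixes f :: "'c \<Rightarrow> real"
  assumes "i \<ge> 1"
  shows "integrable M (\<lambda>\<omega>. f (X i \<omega>)) \<longleftrightarrow> integrable (measure_pmf P) f"
  using integrable_distr_eq[OF X_measurable[OF assms], of f] by (simp add: law[OF assms])

lemma AE_in_set_pmf: "AE \<omega> in M. \<forall>i\<ge>1. X i \<omega> \<in> set_pmf P"
proof -
  have "AE \<omega> in M. X i \<omega> \<in> set_pmf P" if "i \<ge> 1" for i
  proof (rule AE_distrD[OF X_measurable[OF that]])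
    show "AE x in distr M (count_space UNIV) (X i). x \<in> set_pmf P"
      unfolding law[OF that] by (rule AE_measure_pmf)
  qed
  then show ?thesis by (simp add: AE_all_countable)
qed

lemma central_limit_theorem_sample:
  fixes f :: "'c \<Rightarrow> real"
  assumes square_integrable: "integrable (measure_pmf P) (\<lambda>x. (f x)\<^sup>2)"
    and "prob_space N" "centered_gaussian_rv N Z (measure_pmf.variance P f)"
  shows "weak_conv_m
    (\<lambda>n. distr M borel (\<lambda>\<omega>. (\<Sum>i=1..n. f (X i \<omega>) - measure_pmf.expectation P f) / sqrt (real n)))
    (distr N borel Z)"
proof -
  have "indep_vars (\<lambda>_. count_space UNIV) (\<lambda>i. X (Suc i)) UNIV"
    using indep_vars_reindex_inj[of "\<lambda>_. count_space UNIV" X Suc UNIV]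
      indep_vars_subset[OF indep, of "range Suc"] by auto
  then have "indep_vars (\<lambda>_. borel) (\<lambda>i \<omega>. f (X (Suc i) \<omega>)) UNIV"
    by (rule indep_vars_compose2) auto
  then have "weak_conv_m
    (\<lambda>n. distr M borel (\<lambda>\<omega>. (\<Sum>i<n. f (X (Suc i) \<omega>) - measure_pmf.expectation P f) / sqrt (real n)))
    (distr N borel Z)"
  proof (rule central_limit_theorem_centered_gaussian_rv)
    show mean: "expectation (\<lambda>\<omega>. f (X (Suc i) \<omega>)) = measure_pmf.expectation P f" for i
      by (simp add: expectation_X)
    show "variance (\<lambda>\<omega>. f (X (Suc i) \<omega>)) = measure_pmf.variance P f" for i
      unfolding mean by (simp add: expectation_X[where f = "\<lambda>x. (f x - measure_pmf.expectation P f)\<^sup>2"])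
    show "integrable M (\<lambda>\<omega>. (f (X (Suc i) \<omega>))\<^sup>2)" for i
      using square_integrable by (simp add: integrable_X_iff[where f = "\<lambda>x. (f x)\<^sup>2"])
    show "distr M borel (\<lambda>\<omega>. f (X (Suc i) \<omega>)) = distr (measure_pmf P) borel f" for i
      by (simp add: distr_compose_X)
  qed fact+
  then show ?thesis
    by (simp only: One_nat_def sum.atLeast1_atMost_eq)
qed

end

section \<open>The empirical process\<close>

lemma sum_emp_pmf:
  assumes "finite I" "\<And>j. j \<notin> I \<Longrightarrow> f j = 0"
  shows "(\<Sum>k\<in>I. f k * emp_pmf X n \<omega> k) = (\<Sum>i=1..n. f (X i \<omega>)) / real n"
proof -
  have "emp_pmf X n \<omega> k = (\<Sum>i=1..n. of_bool (X i \<omega> = k)) / real n" for k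
    by (simp add: emp_pmf_def of_bool_def sum.If_cases Int_def)
  then have "(\<Sum>k\<in>I. f k * emp_pmf X n \<omega> k) = (\<Sum>k\<in>I. \<Sum>i=1..n. f k * of_bool (X i \<omega> = k)) / real n"
    by (simp only: sum_divide_distrib sum_distrib_left times_divide_eq_right)
  also have "(\<Sum>k\<in>I. \<Sum>i=1..n. f k * of_bool (X i \<omega> = k)) = (\<Sum>i=1..n. \<Sum>k\<in>I. f k * of_bool (X i \<omega> = k))"
    by (rule sum.swap)
  also have "\<dots> = (\<Sum>i=1..n. f (X i \<omega>))"
    using assms by (intro sum.cong) (auto simp: of_bool_def if_distrib[of "\<lambda>t. _ * t"] cong: if_cong)
  finally show ?thesis .
qed

lemma sum_emp_pmf_eq_1:
  assumes "n > 0" "finite I" "\<And>i. i \<in> {1..n} \<Longrightarrow> X i \<omega> \<in> I"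
  shows "(\<Sum>k\<in>I. emp_pmf X n \<omega> k) = 1"
proof -
  have "(\<Sum>k\<in>I. emp_pmf X n \<omega> k) = (\<Sum>k\<in>I. indicator I k * emp_pmf X n \<omega> k)"
    by (intro sum.cong) auto
  also have "\<dots> = (\<Sum>i=1..n. indicator I (X i \<omega>)) / real n"
    using assms(2) by (intro sum_emp_pmf) auto
  also have "(\<Sum>i=1..n. indicator I (X i \<omega>)) = (\<Sum>i=1..n. 1 :: real)"
    using assms(3) by (intro sum.cong) auto
  finally show ?thesis using \<open>n > 0\<close> by simp
qed

text \<open>No condition on \<open>F\<close> is needed because a finite sample takes only countably many values.\<close>

lemma measurable_emp_pmf_functional:
  assumes X_measurable: "\<And>i. i \<ge> 1 \<Longrightarrow> X i \<in> measurable M (count_space UNIV)" and "space N = UNIV"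
  shows "(\<lambda>\<omega>. F (emp_pmf X n \<omega>)) \<in> measurable M N"
proof -
  have "(\<lambda>\<omega>. \<lambda>i\<in>{1..n}. X i \<omega>) \<in> measurable M (PiM {1..n} (\<lambda>_. count_space UNIV))"
    using X_measurable by (intro measurable_restrict) auto
  also have "PiM {1..n} (\<lambda>_. count_space UNIV) = count_space ({1..n} \<rightarrow>\<^sub>E (UNIV :: nat set))"
    by (rule count_space_PiM_finite) auto
  finally have "(\<lambda>\<omega>. F (emp_pmf (\<lambda>i x. x i) n (\<lambda>i\<in>{1..n}. X i \<omega>))) \<in> measurable M N"
    by (rule measurable_compose) (simp add: \<open>space N = UNIV\<close>)
  moreover have "emp_pmf (\<lambda>i x. x i) n (\<lambda>i\<in>{1..n}. X i \<omega>) = emp_pmf X n \<omega>" for \<omega>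
    unfolding emp_pmf_def by (intro ext arg_cong2[where f = "(/)"] arg_cong[where f = "\<lambda>A. real (card A)"]) auto
  ultimately show ?thesis by simp
qed

lemma centered_gaussian_vector_measurable:
  assumes "centered_gaussian_vector N I G C" "finite I" "k \<in> I"
  shows "(\<lambda>\<omega>. G \<omega> k) \<in> borel_measurable N"
proof -
  have "centered_gaussian_rv N (\<lambda>\<omega>. \<Sum>j\<in>I. of_bool (j = k) * G \<omega> j)
      (\<Sum>i\<in>I. \<Sum>j\<in>I. of_bool (i = k) * of_bool (j = k) * C i j)"
    using assms(1) unfolding centered_gaussian_vector_def by (rule spec)
  then have "(\<lambda>\<omega>. \<Sum>j\<in>I. of_bool (j = k) * G \<omega> j) \<in> borel_measurable N"
    by (rule centered_gaussian_rv_measurable)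
  moreover have "(\<Sum>j\<in>I. of_bool (j = k) * G \<omega> j) = G \<omega> k" for \<omega>
    using assms(2,3) by (simp add: of_bool_def if_distrib[of "\<lambda>t. t * _"] cong: if_cong)
  ultimately show ?thesis by simp
qed

locale empirical_process = iid_sample M X P
  for M :: "'a measure" and X :: "nat \<Rightarrow> 'a \<Rightarrow> nat" and P :: "nat pmf"
begin

definition emp_process :: "nat \<Rightarrow> 'a \<Rightarrow> nat \<Rightarrow> real" where
  "emp_process n \<omega> k = sqrt (real n) * (emp_pmf X n \<omega> k - pmf P k)"

lemma emp_process_measurable: "(\<lambda>\<omega>. emp_process n \<omega> k) \<in> borel_measurable M"
  unfolding emp_process_def
  by (rule measurable_emp_pmf_functional[where F = "\<lambda>p. sqrt (real n) * (p k - pmf P k)"])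
    (auto simp: X_measurable)

lemma emp_pmf_Hoeffding:
  assumes "n > 0" "\<delta> \<ge> 0"
  shows "prob {\<omega> \<in> space M. \<delta> \<le> \<bar>emp_pmf X n \<omega> k - pmf P k\<bar>} \<le> 2 * exp (-2 * real n * \<delta>\<^sup>2)"
proof -
  define Y :: "nat \<Rightarrow> 'a \<Rightarrow> real" where "Y i \<omega> = indicator {k} (X i \<omega>)" for i \<omega>
  have Y_indep: "indep_vars (\<lambda>_. borel) Y {1..n}"
    unfolding Y_def by (rule indep_vars_compose2[OF indep_vars_subset[OF indep]]) auto
  have mean: "expectation (Y 1) = pmf P k"
    using expectation_X[of 1 "indicator {k}"] by (simp add: Y_def[abs_def] pmf.rep_eq)
  interpret Hoeffding_ineq_iid M "{1..n}" Y "Y 1" 0 1 "pmf P k"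
  proof unfold_locales
    show "distr M borel (Y i) = distr M borel (Y 1)" if "i \<in> {1..n}" for i
      using that distr_compose_X[of _ "indicator {k} :: nat \<Rightarrow> real"]
      by (simp add: Y_def[abs_def])
    show "random_variable borel (Y 1)"
      using Y_indep \<open>n > 0\<close> by (simp add: indep_vars_def2)
    show "pmf P k \<equiv> expectation (Y 1)" by (simp only: mean)
  qed (use Y_indep in \<open>auto simp: Y_def indicator_def\<close>)
  have "emp_pmf X n \<omega> k = (\<Sum>i=1..n. Y i \<omega>) / real n" for \<omega>
    using sum_emp_pmf[of "{k}" "indicator {k}" X n \<omega>] by (simp add: Y_def)
  then show ?thesis
    using Hoeffding_ineq_abs_ge'[OF \<open>\<delta> \<ge> 0\<close>] \<open>n > 0\<close> by simp
qed

lemma sum_emp_process: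
  assumes "finite I" "\<And>j. j \<notin> I \<Longrightarrow> f j = 0"
  shows "(\<Sum>k\<in>I. f k * emp_process n \<omega> k)
    = (\<Sum>i=1..n. f (X i \<omega>) - measure_pmf.expectation P f) / sqrt (real n)"
proof (cases "n = 0")
  case False
  define m where "m = measure_pmf.expectation P f"
  have "m = (\<Sum>k\<in>I. f k * pmf P k)"
    unfolding m_def using assms by (intro integral_measure_pmf_real) auto
  then have "(\<Sum>k\<in>I. f k * emp_process n \<omega> k) = sqrt (real n) * ((\<Sum>k\<in>I. f k * emp_pmf X n \<omega> k) - m)"
    by (simp add: emp_process_def sum_distrib_left sum_subtractf algebra_simps)
  also have "\<dots> = sqrt (real n) * ((\<Sum>i=1..n. f (X i \<omega>)) / real n - m)"
    using sum_emp_pmf[of I f X n \<omega>, OF assms] by simp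
  also have "\<dots> = ((\<Sum>i=1..n. f (X i \<omega>)) - real n * m) / sqrt (real n)"
    using False by (simp add: field_simps)
  also have "(\<Sum>i=1..n. f (X i \<omega>)) - real n * m = (\<Sum>i=1..n. f (X i \<omega>) - m)"
    by (simp add: sum_subtractf)
  finally show ?thesis by (simp only: m_def)
qed (simp add: emp_process_def)

lemma emp_process_linear_weak_conv:
  assumes "prob_space N" "finite I" and f_zero: "\<And>j. j \<notin> I \<Longrightarrow> f j = 0"
    and gaussian: "centered_gaussian_vector N I G (multinomial_cov (pmf P))"
  shows "weak_conv_m (\<lambda>n. distr M borel (\<lambda>\<omega>. \<Sum>k\<in>I. f k * emp_process n \<omega> k))
    (distr N borel (\<lambda>\<omega>. \<Sum>k\<in>I. f k * G \<omega> k))"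
proof -
  have "integrable (measure_pmf P) (\<lambda>x. (f x)\<^sup>2)"
    using \<open>finite I\<close> by (rule integrable_measure_pmf_finite_support) (simp add: f_zero)
  moreover have "centered_gaussian_rv N (\<lambda>\<omega>. \<Sum>k\<in>I. f k * G \<omega> k) (measure_pmf.variance P f)"
    using gaussian variance_measure_pmf_finite_support[of I f P, OF \<open>finite I\<close> f_zero]
    by (simp add: centered_gaussian_vector_def)
  moreover have "(\<Sum>k\<in>I. f k * emp_process n \<omega> k)
      = (\<Sum>i=1..n. f (X i \<omega>) - measure_pmf.expectation P f) / sqrt (real n)" for n \<omega>
    using \<open>finite I\<close> f_zero by (rule sum_emp_process)
  ultimately show ?thesis
    using central_limit_theorem_sample[OF _ \<open>prob_space N\<close>] by simp
qed

theorem emp_process_cramer_wold: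
  assumes "prob_space N" "finite I"
    and gaussian: "centered_gaussian_vector N I G (multinomial_cov (pmf P))"
  shows "cramer_wold M N I emp_process G"
proof -
  interpret N: prob_space N by fact
  show ?thesis
  proof
    fix c :: "nat \<Rightarrow> real"
    have "(\<Sum>k\<in>I. c k * x k) = (\<Sum>k\<in>I. (if k \<in> I then c k else 0) * x k)" for x
      by (intro sum.cong) auto
    then show "weak_conv_m (\<lambda>n. distr M borel (\<lambda>\<omega>. \<Sum>k\<in>I. c k * emp_process n \<omega> k))
        (distr N borel (\<lambda>\<omega>. \<Sum>k\<in>I. c k * G \<omega> k))"
      using emp_process_linear_weak_conv[OF assms(1,2) _ gaussian, of "\<lambda>k. if k \<in> I then c k else 0"]
      by simp
  qed (use \<open>finite I\<close> emp_process_measurable centered_gaussian_vector_measurable[OF gaussian] in auto)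
qed

end

locale convex_sample = empirical_process M X P + supported_convex_pmf "pmf P" S
  for M :: "'a measure" and X :: "nat \<Rightarrow> 'a \<Rightarrow> nat" and P :: "nat pmf" and S :: nat
begin

lemma Tn_sq_measurable: "Tn_sq X n \<in> borel_measurable M"
  unfolding Tn_sq_def
  by (rule measurable_emp_pmf_functional[where F = "\<lambda>p. real n * sqnorm (\<lambda>j. p j - ls_proj p j)"])
    (auto simp: X_measurable)

lemma Tn_sq_eq_T0_hat_if_near:
  obtains \<delta> where "\<delta> > 0"
    "\<And>n \<omega>. n > 0 \<Longrightarrow> (\<And>i. i \<ge> 1 \<Longrightarrow> X i \<omega> \<in> set_pmf P) \<Longrightarrow>
      (\<And>k. k \<in> {0..S+1} \<Longrightarrow> \<bar>emp_pmf X n \<omega> k - pmf P k\<bar> < \<delta>) \<Longrightarrow>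
      Tn_sq X n \<omega> = T0_hat (pmf P) S (emp_process n \<omega>)"
proof -
  obtain \<delta> where "\<delta> > 0" and sqnorm_near: "\<And>q. (\<And>j. j \<in> {0..S+1} \<Longrightarrow> \<bar>q j - pmf P j\<bar> < \<delta>) \<Longrightarrow>
      (\<And>j. j > S \<Longrightarrow> q j = 0) \<Longrightarrow> (\<Sum>j=0..S+1. q j) = 1 \<Longrightarrow>
      sqnorm (\<lambda>j. q j - ls_proj q j) = T0_hat (pmf P) S (\<lambda>j. q j - pmf P j)"
    using sqnorm_ls_proj_near by blast
  show thesis
  proof (rule that[OF \<open>\<delta> > 0\<close>])
    fix n \<omega>
    assume "n > 0" and X_in: "\<And>i. i \<ge> 1 \<Longrightarrow> X i \<omega> \<in> set_pmf P"
      and near: "\<And>k. k \<in> {0..S+1} \<Longrightarrow> \<bar>emp_pmf X n \<omega> k - pmf P k\<bar> < \<delta>"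
    let ?q = "emp_pmf X n \<omega>"
    have X_le: "X i \<omega> \<le> S" if "i \<ge> 1" for i
      using pmf_positive[OF X_in[OF that]] support by blast
    have "?q j = 0" if "j > S" for j
    proof -
      have "{i \<in> {1..n}. X i \<omega> = j} = {}" using X_le that by fastforce
      then show ?thesis by (simp add: emp_pmf_def)
    qed
    moreover have "(\<Sum>j=0..S+1. ?q j) = 1"
      using \<open>n > 0\<close> X_le by (intro sum_emp_pmf_eq_1) (auto simp: le_SucI)
    ultimately have "sqnorm (\<lambda>j. ?q j - ls_proj ?q j) = T0_hat (pmf P) S (\<lambda>j. ?q j - pmf P j)"
      using sqnorm_near[of ?q] near by blast
    then show "Tn_sq X n \<omega> = T0_hat (pmf P) S (emp_process n \<omega>)"
      using T0_hat_scale[of "sqrt (real n)" "pmf P" S "\<lambda>j. ?q j - pmf P j"] \<open>n > 0\<close>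
      by (simp add: Tn_sq_def emp_process_def[abs_def])
  qed
qed

lemma prob_Tn_sq_neq_T0_hat_le:
  obtains \<delta> where "\<delta> > 0"
    "\<And>n. n > 0 \<Longrightarrow> prob {\<omega> \<in> space M. Tn_sq X n \<omega> \<noteq> T0_hat (pmf P) S (emp_process n \<omega>)}
      \<le> real (card {0..S+1}) * (2 * exp (-2 * real n * \<delta>\<^sup>2))"
proof -
  obtain \<delta> where "\<delta> > 0" and eq_near: "\<And>n \<omega>. n > 0 \<Longrightarrow> (\<And>i. i \<ge> 1 \<Longrightarrow> X i \<omega> \<in> set_pmf P) \<Longrightarrow>
      (\<And>k. k \<in> {0..S+1} \<Longrightarrow> \<bar>emp_pmf X n \<omega> k - pmf P k\<bar> < \<delta>) \<Longrightarrow>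
      Tn_sq X n \<omega> = T0_hat (pmf P) S (emp_process n \<omega>)"
    using Tn_sq_eq_T0_hat_if_near by blast
  define far where "far n = {\<omega> \<in> space M. \<exists>k\<in>{0..S+1}. \<delta> \<le> \<bar>emp_pmf X n \<omega> k - pmf P k\<bar>}" for n
  note [measurable] = Tn_sq_measurable T0_hat_measurable[OF emp_process_measurable]
  have [measurable]: "(\<lambda>\<omega>. emp_pmf X n \<omega> k) \<in> borel_measurable M" for n k
    by (rule measurable_emp_pmf_functional[where F = "\<lambda>p. p k"]) (auto simp: X_measurable)
  show thesis
  proof (rule that[OF \<open>\<delta> > 0\<close>])
    fix n :: nat assume "n > 0"
    have "AE \<omega> in M. Tn_sq X n \<omega> \<noteq> T0_hat (pmf P) S (emp_process n \<omega>) \<longrightarrow> \<omega> \<in> far n"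
      using AE_in_set_pmf AE_space
    proof eventually_elim
      case (elim \<omega>)
      then show ?case using eq_near[OF \<open>n > 0\<close>, of \<omega>] by (force simp: far_def not_le[symmetric])
    qed
    then have "prob {\<omega> \<in> space M. Tn_sq X n \<omega> \<noteq> T0_hat (pmf P) S (emp_process n \<omega>)} \<le> prob (far n)"
      by (intro finite_measure_mono_AE) (auto simp: far_def)
    also have "\<dots> \<le> real (card {0..S+1}) * (2 * exp (-2 * real n * \<delta>\<^sup>2))"
      unfolding far_def using \<open>n > 0\<close> \<open>\<delta> > 0\<close> by (intro prob_Bex_le emp_pmf_Hoeffding) auto
    finally show "prob {\<omega> \<in> space M. Tn_sq X n \<omega> \<noteq> T0_hat (pmf P) S (emp_process n \<omega>)}
        \<le> real (card {0..S+1}) * (2 * exp (-2 * real n * \<delta>\<^sup>2))" .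
  qed
qed

lemma Tn_sq_eq_T0_hat_whp:
  "(\<lambda>n. prob {\<omega> \<in> space M. Tn_sq X n \<omega> \<noteq> T0_hat (pmf P) S (emp_process n \<omega>)}) \<longlonglongrightarrow> 0"
proof -
  obtain \<delta> where "\<delta> > 0" and prob_le: "\<And>n. n > 0 \<Longrightarrow>
      prob {\<omega> \<in> space M. Tn_sq X n \<omega> \<noteq> T0_hat (pmf P) S (emp_process n \<omega>)}
        \<le> real (card {0..S+1}) * (2 * exp (-2 * real n * \<delta>\<^sup>2))"
    using prob_Tn_sq_neq_T0_hat_le by blast
  show ?thesis
  proof (rule Lim_null_comparison)
    show "\<forall>\<^sub>F n in sequentially. norm (prob {\<omega> \<in> space M. Tn_sq X n \<omega> \<noteq> T0_hat (pmf P) S (emp_process n \<omega>)})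
        \<le> real (card {0..S+1}) * (2 * exp (-2 * real n * \<delta>\<^sup>2))"
      using prob_le by (intro eventually_sequentiallyI[of 1]) auto
    have "(\<lambda>n. exp (-2 * \<delta>\<^sup>2) ^ n) \<longlonglongrightarrow> 0"
      using \<open>\<delta> > 0\<close> by (intro LIMSEQ_realpow_zero) auto
    also have "(\<lambda>n. exp (-2 * \<delta>\<^sup>2) ^ n) = (\<lambda>n. exp (-2 * real n * \<delta>\<^sup>2))"
      by (simp add: exp_of_nat_mult[symmetric] mult_ac)
    finally show "(\<lambda>n. real (card {0..S+1}) * (2 * exp (-2 * real n * \<delta>\<^sup>2))) \<longlonglongrightarrow> 0"
      by (intro tendsto_mult_right_zero)
  qed
qed

theorem Tn_sq_weak_conv:
  assumes "prob_space N"
    and "centered_gaussian_vector N {0..S+1} G (multinomial_cov (pmf P))"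
  shows "weak_conv_m (\<lambda>n. distr M borel (Tn_sq X n)) (distr N borel (\<lambda>\<omega>. T0_hat (pmf P) S (G \<omega>)))"
proof (rule weak_conv_m_if_eq_whp)
  interpret cramer_wold M N "{0..S+1}" emp_process G
    using assms by (intro emp_process_cramer_wold) auto
  show "weak_conv_m (\<lambda>n. distr M borel (\<lambda>\<omega>. T0_hat (pmf P) S (emp_process n \<omega>)))
      (distr N borel (\<lambda>\<omega>. T0_hat (pmf P) S (G \<omega>)))"
    by (rule weak_conv_continuous_map[OF continuous_on_T0_hat depends_only_on_T0_hat])
  show "real_distribution (distr N borel (\<lambda>\<omega>. T0_hat (pmf P) S (G \<omega>)))"
    by (rule N.real_distribution_distr[OF T0_hat_measurable[OF G_measurable]])
qed (rule Tn_sq_measurable T0_hat_measurable emp_process_measurable Tn_sq_eq_T0_hat_whp)+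

end

lemma (in prob_space) convex_sample_exists:
  assumes "is_pmf p0" "\<And>j. p0 j > 0 \<longleftrightarrow> j \<le> S" "convex_seq p0"
    and indep: "indep_vars (\<lambda>_. count_space UNIV) X {1..}"
    and law: "\<And>i j. i \<ge> 1 \<Longrightarrow> prob {\<omega> \<in> space M. X i \<omega> = j} = p0 j"
  obtains P where "pmf P = p0" "convex_sample M X P S"
proof -
  have convex: "supported_convex_pmf p0 S"
    using assms(1-3) by (simp add: supported_convex_pmf_def)
  obtain P where pmf_P: "pmf P = p0"
    using pmf_with_finite_support_exists[OF assms(1), of "{..S}"]
      supported_convex_pmf.zero_beyond_support[OF convex] by auto
  have "distr M (count_space UNIV) (X i) = measure_pmf P" if "i \<ge> 1" for i
    using indep law that pmf_P by (intro distr_eq_measure_pmf) (auto simp: indep_vars_def2)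
  then have "convex_sample M X P S"
    using indep convex pmf_P
    by (simp add: convex_sample_def empirical_process_def iid_sample_def iid_sample_axioms_def prob_space_axioms)
  then show thesis using pmf_P that by blast
qed

theorem theorem1:
  fixes M :: "'a measure" and X :: "nat \<Rightarrow> 'a \<Rightarrow> nat" and p0 :: "nat \<Rightarrow> real" and S :: nat
    and N :: "'b measure" and g0 :: "'b \<Rightarrow> nat \<Rightarrow> real"
  assumes "prob_space M"
    and "S > 0"
    and "is_pmf p0"
    and "\<forall>j. p0 j > 0 \<longleftrightarrow> j \<le> S"
    and "convex_seq p0"
    and "prob_space.indep_vars M (\<lambda>_. count_space UNIV) X {1..}"
    and "\<forall>i\<ge>1. \<forall>j. measure M {\<omega> \<in> space M. X i \<omega> = j} = p0 j"
    and "prob_space N"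
    and "centered_gaussian_vector N {0..S+1} g0
           (\<lambda>i j. (if i = j then p0 i else 0) - p0 i * p0 j)"
  shows "weak_conv_m (\<lambda>n. distr M borel (Tn_sq X n)) (distr N borel (\<lambda>\<omega>. T0_hat p0 S (g0 \<omega>)))"
proof -
  interpret prob_space M by fact
  obtain P where pmf_P: "pmf P = p0" and "convex_sample M X P S"
    using convex_sample_exists[of p0 S X] assms(3-7) by blast
  then interpret convex_sample M X P S by simp
  show ?thesis
    using Tn_sq_weak_conv[OF assms(8)] assms(9) unfolding pmf_P multinomial_cov_def[abs_def] .
qed

end
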